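(* Let $N$ be a supernatural number, $n\in\mathbb Z$, and let $\delta:\mathcal B(N)\to B(N)$ be an $n$-covariant derivation in $B(N)$. If $N$ is infinite and $n\neq0$, or $N$ is finite and $N\nmid n$, then $\delta$ is an inner derivation. Otherwise there exists a unique constant $C_n\in\mathbb C$ such that $$\delta(a)=C_n[V^n\mathbb L,a]+\tilde\delta(a)$$ for every $a\in\mathcal B(N)$, where, if $N$ is finite and $N\mid n$, $\tilde\delta$ is an inner derivation, and, if $N$ is infinite and $n=0$, $\tilde\delta$ is an approximately inner derivation.
   Context: A supernatural number is a formal product $N=\prod_{p\text{ prime}}p^{\epsilon_p}$ with $\epsilon_p\in\{0,1,\dots,\infty\}$; it is finite (an ordinary positive integer) if $\sum_p\epsilon_p<\infty$, and infinite otherwise. A positive integer $j$ divides $N$ ($j\mid N$) if for each prime $p$ the exponent of $p$ in $j$ is at most $\epsilon_p$. On $\ell^2(\mathbb Z)$ with canonical basis $\{E_l\}_{l\in\mathbb Z}$ let $VE_l=E_{l+1}$ be the bilateral shift, $\mathbb LE_l=lE_l$, and for a sequence $b(l)$ let $b(\mathbb L)E_l=b(l)E_l$. Let $\mathcal B_{\mathrm{diag}}(N)=\{b(\mathbb L): b(l+j)=b(l)\ \forall l,\text{ for some positive integer } j\mid N\}$. The Bunce-Deddens algebra is (up to isomorphism) $B(N)=\mathrm C^*(V,\mathcal B_{\mathrm{diag}}(N))$; $\mathcal B(N)$ is the $^*$-subalgebra generated algebraically by $V,V^{-1}$ and $\mathcal B_{\mathrm{diag}}(N)$. A derivation in $B(N)$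 is a linear map $\delta:\mathcal B(N)\to B(N)$ with $\delta(ab)=\delta(a)b+a\,\delta(b)$. It is inner if $\delta(b)=[z,b]$ for some $z\in B(N)$ and all $b\in\mathcal B(N)$, and approximately inner if there are $z_j\in B(N)$ with $\delta(b)=\lim_{j\to\infty}[z_j,b]$ (in norm) for all $b\in\mathcal B(N)$. Let $\rho_\theta(b)=e^{i\theta\mathbb L}be^{-i\theta\mathbb L}$, an automorphism of $B(N)$ preserving $\mathcal B(N)$. $\delta$ is $n$-covariant if $\rho_\theta^{-1}(\delta(\rho_\theta(b)))=e^{-in\theta}\delta(b)$ for all $\theta\in[0,2\pi)$, $b\in\mathcal B(N)$. Commutators with unbounded operators are computed on the linear span of $\{E_l\}$ (which $\mathcal B(N)$ preserves) and then extended to bounded operators. *)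

theory Defs
  imports "HOL-Analysis.Analysis" "HOL-Computational_Algebra.Primes"
begin

text \<open>A supernatural number is given by its exponents; only the values at primes matter.\<close>

type_synonym supernatural = "nat \<Rightarrow> enat"

definition sn_finite :: "supernatural \<Rightarrow> bool" where
  "sn_finite N \<longleftrightarrow> (\<Sum>\<^sub>\<infinity>p\<in>{p. prime p}. N p) < \<infinity>"

text \<open>The positive integer represented by a finite supernatural number.\<close>

definition sn_value :: "supernatural \<Rightarrow> nat" where
  "sn_value N = (\<Prod>p\<in>{p. prime p \<and> N p \<noteq> 0}. p ^ the_enat (N p))"

definition sn_divides :: "nat \<Rightarrow> supernatural \<Rightarrow> bool" where
  "sn_divides j N \<longleftrightarrow> 0 < j \<and> (\<forall>p. prime p \<longrightarrow> enat (multiplicity p j) \<le> N p)"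

lemma sn_finite_iff:
  "sn_finite N \<longleftrightarrow> finite {p. prime p \<and> N p \<noteq> 0} \<and> (\<forall>p. prime p \<longrightarrow> N p \<noteq> \<infinity>)"
proof
  have sup: "(\<Sum>\<^sub>\<infinity>p\<in>{p. prime p}. N p) = (SUP F\<in>{F. finite F \<and> F \<subseteq> {p. prime p}}. sum N F)"
    by (rule nonneg_infsum_complete) simp
  assume "sn_finite N"
  then obtain k where k: "(\<Sum>\<^sub>\<infinity>p\<in>{p. prime p}. N p) = enat k"
    unfolding sn_finite_def by auto
  have le: "sum N F \<le> enat k" if "finite F" "F \<subseteq> {p. prime p}" for F
    using that k sup by (metis (mono_tags, lifting) SUP_upper mem_Collect_eq)
  have "N p \<noteq> \<infinity>" if "prime p" for p
    using le[of "{p}"] that by (cases "N p") auto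
  moreover have "finite {p. prime p \<and> N p \<noteq> 0}"
  proof (rule ccontr)
    assume "infinite {p. prime p \<and> N p \<noteq> 0}"
    then obtain F where F: "F \<subseteq> {p. prime p \<and> N p \<noteq> 0}" "finite F" "card F = Suc k"
      using infinite_arbitrarily_large by metis
    have "of_nat (card F) = (\<Sum>p\<in>F. (1::enat))" by simp
    also have "\<dots> \<le> sum N F"
      using F(1) by (intro sum_mono) (auto simp: ileI1 one_eSuc zero_less_iff_neq_zero)
    also have "\<dots> \<le> enat k" using F by (intro le) auto
    finally show False using F(3) by (simp add: of_nat_eq_enat)
  qed
  ultimately show "finite {p. prime p \<and> N p \<noteq> 0} \<and> (\<forall>p. prime p \<longrightarrow> N p \<noteq> \<infinity>)" by blast
next
  assume R: "finite {p. prime p \<and> N p \<noteq> 0} \<and> (\<forall>p. prime p \<longrightarrow> N p \<noteq> \<infinity>)"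
  have "(\<Sum>\<^sub>\<infinity>p\<in>{p. prime p}. N p) = (\<Sum>\<^sub>\<infinity>p\<in>{p. prime p \<and> N p \<noteq> 0}. N p)"
    by (rule infsum_cong_neutral) auto
  also have "\<dots> = (\<Sum>p\<in>{p. prime p \<and> N p \<noteq> 0}. N p)" using R by simp
  also have "\<dots> = (\<Sum>p\<in>{p. prime p \<and> N p \<noteq> 0}. enat (the_enat (N p)))"
    using R by (intro sum.cong) auto
  also have "\<dots> = of_nat (\<Sum>p\<in>{p. prime p \<and> N p \<noteq> 0}. the_enat (N p))"
    by (simp add: of_nat_eq_enat[symmetric])
  also have "\<dots> < \<infinity>" by (simp add: of_nat_eq_enat)
  finally show "sn_finite N" by (simp add: sn_finite_def)
qed

typedef ell2 = "{f :: int \<Rightarrow> complex. (\<lambda>l. (cmod (f l))\<^sup>2) summable_on UNIV}"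
  morphisms coord Abs_ell2
  by (rule exI[of _ "\<lambda>_. 0"]) simp

setup_lifting type_definition_ell2

lemma ell2_dom:
  assumes "(\<lambda>l. B * (cmod (g l))\<^sup>2) summable_on UNIV" "\<And>l. (cmod (f l))\<^sup>2 \<le> B * (cmod (g l))\<^sup>2"
  shows "(\<lambda>l::int. (cmod (f l))\<^sup>2) summable_on UNIV"
  by (rule summable_on_comparison_test[OF assms(1)]) (use assms(2) in auto)

lemma ell2_scale:
  assumes "(\<lambda>l. (cmod (f l))\<^sup>2) summable_on UNIV" "\<And>l. cmod (b l) \<le> B"
  shows "(\<lambda>l::int. (cmod (b l * f l))\<^sup>2) summable_on UNIV"
proof (rule ell2_dom[of "B\<^sup>2" f])
  show "(\<lambda>l. B\<^sup>2 * (cmod (f l))\<^sup>2) summable_on UNIV"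
    by (intro summable_on_cmult_right assms)
  show "(cmod (b l * f l))\<^sup>2 \<le> B\<^sup>2 * (cmod (f l))\<^sup>2" for l
    using assms(2) by (simp add: norm_mult power_mult_distrib mult_right_mono power_mono)
qed

lemma ell2_add:
  assumes "(\<lambda>l. (cmod (f l))\<^sup>2) summable_on UNIV" "(\<lambda>l. (cmod (g l))\<^sup>2) summable_on UNIV"
  shows "(\<lambda>l::int. (cmod (f l + g l))\<^sup>2) summable_on UNIV"
proof (rule summable_on_comparison_test)
  show "(\<lambda>l. 2 * ((cmod (f l))\<^sup>2 + (cmod (g l))\<^sup>2)) summable_on UNIV"
    by (intro summable_on_cmult_right summable_on_add assms)
  show "(cmod (f l + g l))\<^sup>2 \<le> 2 * ((cmod (f l))\<^sup>2 + (cmod (g l))\<^sup>2)" for l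
  proof -
    have "(cmod (f l + g l))\<^sup>2 \<le> (cmod (f l) + cmod (g l))\<^sup>2"
      by (intro power_mono norm_triangle_ineq) auto
    also have "\<dots> \<le> 2 * ((cmod (f l))\<^sup>2 + (cmod (g l))\<^sup>2)"
      using sum_squares_bound[of "cmod (f l)" "cmod (g l)"] by (simp add: power2_sum)
    finally show ?thesis .
  qed
qed simp

lemma ell2_neg:
  "(\<lambda>l::int. (cmod (f l))\<^sup>2) summable_on UNIV \<Longrightarrow> (\<lambda>l. (cmod (- f l))\<^sup>2) summable_on UNIV"
  by simp

lemma coord_summable: "(\<lambda>l. (cmod (coord f l))\<^sup>2) summable_on UNIV"
  using coord[of f] by simp

lemma coord_inner_abs_summable:
  "(\<lambda>l. cmod (coord f l) * cmod (coord g l)) summable_on UNIV"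
proof (rule summable_on_comparison_test)
  show "(\<lambda>l. (cmod (coord f l))\<^sup>2 + (cmod (coord g l))\<^sup>2) summable_on UNIV"
    by (intro summable_on_add coord_summable)
  show "cmod (coord f l) * cmod (coord g l) \<le> (cmod (coord f l))\<^sup>2 + (cmod (coord g l))\<^sup>2" for l
    using sum_squares_bound[of "cmod (coord f l)" "cmod (coord g l)"]
      mult_nonneg_nonneg[OF norm_ge_zero norm_ge_zero, of "coord f l" "coord g l"]
    by linarith
qed simp

lemma coord_inner_summable: "(\<lambda>l. coord f l \<bullet> coord g l) summable_on UNIV"
proof (rule abs_summable_summable, rule summable_on_comparison_test[OF coord_inner_abs_summable])
  show "norm (coord f l \<bullet> coord g l) \<le> cmod (coord f l) * cmod (coord g l)" for l
    by (simp add: Cauchy_Schwarz_ineq2)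
qed simp

lift_definition cscale :: "complex \<Rightarrow> ell2 \<Rightarrow> ell2" is "\<lambda>c f l. c * f l"
  by (rule ell2_scale[where B = "cmod _"]) auto

text \<open>The real inner product below is the real part of the complex one; its norm is the
  usual one of \<open>\<ell>\<^sup>2\<close>.\<close>

instantiation ell2 :: real_inner
begin

lift_definition zero_ell2 :: ell2 is "\<lambda>_. 0" by simp
lift_definition plus_ell2 :: "ell2 \<Rightarrow> ell2 \<Rightarrow> ell2" is "\<lambda>f g l. f l + g l" by (rule ell2_add)
lift_definition uminus_ell2 :: "ell2 \<Rightarrow> ell2" is "\<lambda>f l. - f l" by (rule ell2_neg)
lift_definition minus_ell2 :: "ell2 \<Rightarrow> ell2 \<Rightarrow> ell2" is "\<lambda>f g l. f l - g l"
  subgoal for f g using ell2_add[of f "\<lambda>l. - g l"] by simp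
  done
definition scaleR_ell2 :: "real \<Rightarrow> ell2 \<Rightarrow> ell2" where
  "scaleR_ell2 r f = cscale (complex_of_real r) f"
definition inner_ell2 :: "ell2 \<Rightarrow> ell2 \<Rightarrow> real" where
  "inner_ell2 f g = (\<Sum>\<^sub>\<infinity>l. coord f l \<bullet> coord g l)"
definition norm_ell2 :: "ell2 \<Rightarrow> real" where
  "norm_ell2 f = sqrt (\<Sum>\<^sub>\<infinity>l. (cmod (coord f l))\<^sup>2)"
definition dist_ell2 :: "ell2 \<Rightarrow> ell2 \<Rightarrow> real" where
  "dist_ell2 f g = norm (f - g)"
definition sgn_ell2 :: "ell2 \<Rightarrow> ell2" where
  "sgn_ell2 f = scaleR (inverse (norm f)) f"
definition uniformity_ell2 :: "(ell2 \<times> ell2) filter" where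
  "uniformity_ell2 = (INF e\<in>{0 <..}. principal {(x, y). dist x y < e})"
definition open_ell2 :: "ell2 set \<Rightarrow> bool" where
  "open_ell2 U = (\<forall>x\<in>U. \<forall>\<^sub>F (x', y) in uniformity. x' = x \<longrightarrow> y \<in> U)"

instance
proof
  fix f g h :: ell2 and r s :: real
  show "f + g + h = f + (g + h)" by transfer (simp add: add.assoc)
  show "f + g = g + f" by transfer (simp add: add.commute)
  show "0 + f = f" by transfer simp
  show "- f + f = 0" by transfer simp
  show "f - g = f + - g" by transfer simp
  show "r *\<^sub>R (f + g) = r *\<^sub>R f + r *\<^sub>R g"
    unfolding scaleR_ell2_def by transfer (simp add: algebra_simps)
  show "(r + s) *\<^sub>R f = r *\<^sub>R f + s *\<^sub>R f"
    unfolding scaleR_ell2_def by transfer (simp add: algebra_simps)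
  show "r *\<^sub>R s *\<^sub>R f = (r * s) *\<^sub>R f"
    unfolding scaleR_ell2_def by transfer (simp add: algebra_simps)
  show "1 *\<^sub>R f = f" unfolding scaleR_ell2_def by transfer simp
  show "sgn f = scaleR (inverse (norm f)) f" by (simp add: sgn_ell2_def)
  show "dist f g = norm (f - g)" by (rule dist_ell2_def)
  show "uniformity = (INF e\<in>{0 <..}. principal {(x, y :: ell2). dist x y < e})"
    by (rule uniformity_ell2_def)
  show "open U = (\<forall>x\<in>U. \<forall>\<^sub>F (x', y) in uniformity. x' = x \<longrightarrow> y \<in> U)" for U :: "ell2 set"
    by (rule open_ell2_def)
  show "f \<bullet> g = g \<bullet> f" by (simp add: inner_ell2_def inner_commute)
  show "(f + g) \<bullet> h = f \<bullet> h + g \<bullet> h"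
    unfolding inner_ell2_def
    by (simp add: plus_ell2.rep_eq inner_add_left infsum_add coord_inner_summable)
  show "r *\<^sub>R f \<bullet> g = r * (f \<bullet> g)"
  proof -
    have "coord (r *\<^sub>R f) l \<bullet> coord g l = r * (coord f l \<bullet> coord g l)" for l
      by (simp add: scaleR_ell2_def cscale.rep_eq inner_complex_def algebra_simps)
    then show ?thesis
      by (simp add: inner_ell2_def infsum_cmult_right' )
  qed
  show "0 \<le> f \<bullet> f" unfolding inner_ell2_def by (intro infsum_nonneg) simp
  show "f \<bullet> f = 0 \<longleftrightarrow> f = 0"
  proof
    assume z: "f \<bullet> f = 0"
    have "coord f l = 0" for l
    proof -
      have "coord f l \<bullet> coord f l = 0"
        by (rule nonneg_infsum_le_0D[where A = UNIV and f = "\<lambda>l. coord f l \<bullet> coord f l"])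
          (use z in \<open>auto simp: inner_ell2_def coord_inner_summable\<close>)
      then show ?thesis by simp
    qed
    then show "f = 0" by (simp add: coord_inject[symmetric] zero_ell2.rep_eq fun_eq_iff)
  next
    assume "f = 0"
    then show "f \<bullet> f = 0" by (simp add: inner_ell2_def zero_ell2.rep_eq)
  qed
  show "norm f = sqrt (f \<bullet> f)"
    by (simp add: norm_ell2_def inner_ell2_def power2_norm_eq_inner)
qed

end

definition cinner :: "ell2 \<Rightarrow> ell2 \<Rightarrow> complex" where
  "cinner f g = (\<Sum>\<^sub>\<infinity>l. coord f l * cnj (coord g l))"

lift_definition E :: "int \<Rightarrow> ell2" is "\<lambda>l k. if k = l then 1 else 0"
  subgoal for l
    by (rule summable_on_cong_neutral[where S = "{l}" and f = "\<lambda>_. 1", THEN iffD1]) auto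
  done

interpretation ell2c: vector_space cscale
  by unfold_locales (transfer; simp add: algebra_simps)+

lemma ell2_eqI: "(\<And>l. coord f l = coord g l) \<Longrightarrow> f = g"
  by (simp add: coord_inject[symmetric] fun_eq_iff)

lemma norm_ell2_sq: "(norm f)\<^sup>2 = (\<Sum>\<^sub>\<infinity>l. (cmod (coord f l))\<^sup>2)"
  by (simp add: norm_ell2_def infsum_nonneg)

text \<open>Bounded operators are taken from the library type of bounded real-linear maps (with its
  operator norm); complex linearity is imposed where it is needed by \<open>clinear_op\<close>.\<close>

type_synonym ell2_op = "ell2 \<Rightarrow>\<^sub>L ell2"

definition clinear_op :: "ell2_op \<Rightarrow> bool" where
  "clinear_op A \<longleftrightarrow> (\<forall>c f. A (cscale c f) = cscale c (A f))"

definition cscale_op :: "complex \<Rightarrow> ell2_op \<Rightarrow> ell2_op" where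
  "cscale_op c A = Blinfun (\<lambda>f. cscale c (A f))"

definition is_adjoint :: "ell2_op \<Rightarrow> ell2_op \<Rightarrow> bool" where
  "is_adjoint A B \<longleftrightarrow> (\<forall>f g. cinner (A f) g = cinner f (B g))"

text \<open>\<open>mult_seq b\<close> is the possibly unbounded operator \<open>b(\<L>)\<close>, \<open>\<L> E\<^sub>l = l E\<^sub>l\<close>; its values
  are meaningful on sequences \<open>f\<close> for which \<open>b f\<close> is square summable.\<close>

definition mult_seq :: "(int \<Rightarrow> complex) \<Rightarrow> ell2 \<Rightarrow> ell2" where
  "mult_seq b f = Abs_ell2 (\<lambda>l. b l * coord f l)"

text \<open>The bounded operator \<open>b(\<L>)\<close>, for bounded \<open>b\<close>.\<close>

definition diag_op :: "(int \<Rightarrow> complex) \<Rightarrow> ell2_op" where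
  "diag_op b = Blinfun (mult_seq b)"

lift_definition shift_seq :: "int \<Rightarrow> ell2 \<Rightarrow> ell2" is "\<lambda>n f l. f (l - n)"
  subgoal for n f
    using summable_on_reindex_bij_betw[of "\<lambda>l. l - n" UNIV UNIV "\<lambda>l. (cmod (f l))\<^sup>2"]
    by (simp add: bij_betw_def inj_on_def surj_diff_right)
  done

text \<open>\<open>V_pow n\<close> is the power \<open>V\<^sup>n\<close> of the bilateral shift \<open>V\<close>, for every integer \<open>n\<close>;
  see \<open>V_E\<close>, \<open>V_pow_0\<close> and \<open>V_pow_add\<close> below.\<close>

definition V_pow :: "int \<Rightarrow> ell2_op" where
  "V_pow n = Blinfun (shift_seq n)"

abbreviation V :: ell2_op where "V \<equiv> V_pow 1"

lemma cscale_norm: "norm (cscale c f) = cmod c * norm f"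
proof -
  have "(norm (cscale c f))\<^sup>2 = (cmod c * norm f)\<^sup>2"
    unfolding power_mult_distrib norm_ell2_sq
    by (simp add: cscale.rep_eq norm_mult power_mult_distrib infsum_cmult_right')
  then show ?thesis by simp
qed

lemma scaleR_ell2_eq: "r *\<^sub>R f = cscale (of_real r) f"
  by (rule scaleR_ell2_def)

lemma bounded_linear_cscale: "bounded_linear (cscale c)"
proof (rule bounded_linear_intro[where K = "cmod c"])
  show "cscale c (r *\<^sub>R f) = r *\<^sub>R cscale c f" for r f
    by (simp add: scaleR_ell2_eq mult.commute)
qed (auto simp: ell2c.scale_right_distrib cscale_norm mult.commute)

lemma cscale_op_apply [simp]: "cscale_op c A f = cscale c (A f)"
  unfolding cscale_op_def
  by (subst bounded_linear_Blinfun_apply)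
    (auto intro: bounded_linear_compose[OF bounded_linear_cscale blinfun.bounded_linear_right])

lemma coord_mult_seq:
  assumes "bounded (range b)"
  shows "coord (mult_seq b f) l = b l * coord f l"
proof -
  obtain B where "\<And>l. cmod (b l) \<le> B" using assms by (auto simp: bounded_iff)
  then show ?thesis
    unfolding mult_seq_def by (subst Abs_ell2_inverse) (auto intro: ell2_scale[OF coord_summable])
qed

lemma diag_op_coord:
  assumes "bounded (range b)"
  shows "coord (diag_op b f) l = b l * coord f l"
proof -
  obtain B where B: "\<And>l. cmod (b l) \<le> B" using assms by (auto simp: bounded_iff)
  have B0: "0 \<le> B" using B[of 0] norm_ge_zero order_trans by blast
  have "bounded_linear (mult_seq b)"
  proof (rule bounded_linear_intro[where K = B])
    show "norm (mult_seq b f) \<le> norm f * B" for f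
    proof (rule power2_le_imp_le)
      have "(norm (mult_seq b f))\<^sup>2 = (\<Sum>\<^sub>\<infinity>l. (cmod (b l * coord f l))\<^sup>2)"
        by (simp add: norm_ell2_sq coord_mult_seq[OF assms])
      also have "\<dots> \<le> (\<Sum>\<^sub>\<infinity>l. B\<^sup>2 * (cmod (coord f l))\<^sup>2)"
      proof (rule infsum_mono)
        show "(\<lambda>l. (cmod (b l * coord f l))\<^sup>2) summable_on UNIV"
          by (rule ell2_scale[OF coord_summable B])
        show "(\<lambda>l. B\<^sup>2 * (cmod (coord f l))\<^sup>2) summable_on UNIV"
          by (intro summable_on_cmult_right coord_summable)
        show "(cmod (b l * coord f l))\<^sup>2 \<le> B\<^sup>2 * (cmod (coord f l))\<^sup>2" for l
          using B by (simp add: norm_mult power_mult_distrib mult_right_mono power_mono)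
      qed
      also have "\<dots> = (norm f * B)\<^sup>2"
        by (simp add: infsum_cmult_right' norm_ell2_sq power_mult_distrib mult.commute)
      finally show "(norm (mult_seq b f))\<^sup>2 \<le> (norm f * B)\<^sup>2" .
      show "0 \<le> norm f * B" using B0 by simp
    qed
  qed (auto intro!: ell2_eqI simp: coord_mult_seq[OF assms] plus_ell2.rep_eq scaleR_ell2_eq
      cscale.rep_eq algebra_simps)
  then show ?thesis
    by (simp add: diag_op_def bounded_linear_Blinfun_apply coord_mult_seq[OF assms])
qed

lemma diag_op_E: "bounded (range b) \<Longrightarrow> diag_op b (E l) = cscale (b l) (E l)"
  by (rule ell2_eqI) (simp add: diag_op_coord cscale.rep_eq E.rep_eq)

lemma mult_seq_E: "mult_seq b (E l) = cscale (b l) (E l)"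
proof -
  have "(\<lambda>k. b k * coord (E l) k) = coord (cscale (b l) (E l))"
    by (auto simp: cscale.rep_eq E.rep_eq)
  then show ?thesis by (simp add: mult_seq_def coord_inverse)
qed

lemma V_pow_coord: "coord (V_pow n f) l = coord f (l - n)"
proof -
  have "bounded_linear (shift_seq n)"
  proof (rule bounded_linear_intro[where K = 1])
    show "norm (shift_seq n f) \<le> norm f * 1" for f
    proof -
      have "(norm (shift_seq n f))\<^sup>2 = (norm f)\<^sup>2"
        unfolding norm_ell2_sq shift_seq.rep_eq
        using infsum_reindex_bij_betw[of "\<lambda>l. l - n" UNIV UNIV "\<lambda>l. (cmod (coord f l))\<^sup>2"]
        by (simp add: bij_betw_def inj_on_def surj_diff_right)
      then show ?thesis by simp
    qed
  qed (auto intro!: ell2_eqI simp: shift_seq.rep_eq plus_ell2.rep_eq scaleR_ell2_eq cscale.rep_eq)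
  then show ?thesis
    by (simp add: V_pow_def bounded_linear_Blinfun_apply shift_seq.rep_eq)
qed

lemma V_E: "V (E l) = E (l + 1)"
  by (rule ell2_eqI) (auto simp: V_pow_coord E.rep_eq)

lemma V_pow_0: "V_pow 0 = id_blinfun"
  by (intro blinfun_eqI ell2_eqI) (simp add: V_pow_coord)

lemma V_pow_add: "V_pow (m + n) = V_pow m o\<^sub>L V_pow n"
  by (intro blinfun_eqI ell2_eqI) (simp add: V_pow_coord algebra_simps)

definition star_subalgebra :: "ell2_op set \<Rightarrow> bool" where
  "star_subalgebra S \<longleftrightarrow> 0 \<in> S \<and>
    (\<forall>A\<in>S. clinear_op A) \<and>
    (\<forall>A\<in>S. \<forall>B\<in>S. A + B \<in> S) \<and>
    (\<forall>c. \<forall>A\<in>S. cscale_op c A \<in> S) \<and>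
    (\<forall>A\<in>S. \<forall>B\<in>S. A o\<^sub>L B \<in> S) \<and>
    (\<forall>A\<in>S. \<forall>B. clinear_op B \<and> is_adjoint A B \<longrightarrow> B \<in> S)"

definition Bdiag :: "supernatural \<Rightarrow> ell2_op set" where
  "Bdiag N = {diag_op b | b. \<exists>j. sn_divides j N \<and> (\<forall>l. b (l + int j) = b l)}"

definition BD_alg :: "supernatural \<Rightarrow> ell2_op set" where
  "BD_alg N = star_subalgebra hull ({V, V_pow (- 1)} \<union> Bdiag N)"

definition BD :: "supernatural \<Rightarrow> ell2_op set" where
  "BD N = (\<lambda>S. star_subalgebra S \<and> closed S) hull ({V} \<union> Bdiag N)"

definition commutator :: "ell2_op \<Rightarrow> ell2_op \<Rightarrow> ell2_op" where
  "commutator A B = (A o\<^sub>L B) - (B o\<^sub>L A)"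

definition derivation :: "supernatural \<Rightarrow> (ell2_op \<Rightarrow> ell2_op) \<Rightarrow> bool" where
  "derivation N \<delta> \<longleftrightarrow>
    (\<forall>a\<in>BD_alg N. \<delta> a \<in> BD N) \<and>
    (\<forall>a\<in>BD_alg N. \<forall>b\<in>BD_alg N. \<delta> (a + b) = \<delta> a + \<delta> b) \<and>
    (\<forall>c. \<forall>a\<in>BD_alg N. \<delta> (cscale_op c a) = cscale_op c (\<delta> a)) \<and>
    (\<forall>a\<in>BD_alg N. \<forall>b\<in>BD_alg N. \<delta> (a o\<^sub>L b) = (\<delta> a o\<^sub>L b) + (a o\<^sub>L \<delta> b))"

definition inner_derivation :: "supernatural \<Rightarrow> (ell2_op \<Rightarrow> ell2_op) \<Rightarrow> bool" where
  "inner_derivation N \<delta> \<longleftrightarrow> derivation N \<delta> \<and>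
    (\<exists>z\<in>BD N. \<forall>b\<in>BD_alg N. \<delta> b = commutator z b)"

definition approx_inner_derivation :: "supernatural \<Rightarrow> (ell2_op \<Rightarrow> ell2_op) \<Rightarrow> bool" where
  "approx_inner_derivation N \<delta> \<longleftrightarrow> derivation N \<delta> \<and>
    (\<exists>z :: nat \<Rightarrow> ell2_op. (\<forall>j. z j \<in> BD N) \<and>
      (\<forall>b\<in>BD_alg N. (\<lambda>j. commutator (z j) b) \<longlonglongrightarrow> \<delta> b))"

definition rho :: "real \<Rightarrow> ell2_op \<Rightarrow> ell2_op" where
  "rho \<theta> b = diag_op (\<lambda>l. cis (\<theta> * of_int l)) o\<^sub>L b o\<^sub>L diag_op (\<lambda>l. cis (- (\<theta> * of_int l)))"

definition covariant :: "supernatural \<Rightarrow> int \<Rightarrow> (ell2_op \<Rightarrow> ell2_op) \<Rightarrow> bool" where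
  "covariant N n \<delta> \<longleftrightarrow> (\<forall>\<theta>\<in>{0..<2 * pi}. \<forall>b\<in>BD_alg N.
    inv (rho \<theta>) (\<delta> (rho \<theta> b)) = cscale_op (cis (- (of_int n * \<theta>))) (\<delta> b))"

lemma inv_rho: "inv (rho \<theta>) = rho (- \<theta>)"
proof -
  have bd: "bounded (range (\<lambda>l. cis (f l)))" for f :: "int \<Rightarrow> real"
    by (auto simp: bounded_iff)
  have one: "diag_op (\<lambda>l. cis (f l)) o\<^sub>L diag_op (\<lambda>l. cis (- f l)) = id_blinfun"
    "diag_op (\<lambda>l. cis (- f l)) o\<^sub>L diag_op (\<lambda>l. cis (f l)) = id_blinfun" for f :: "int \<Rightarrow> real"
    by (intro blinfun_eqI ell2_eqI;
        simp add: diag_op_coord[OF bd] mult.assoc[symmetric] cis_mult)+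
  have "rho (- t) (rho t b) = b" for t b
  proof -
    have "rho (- t) (rho t b) =
      (diag_op (\<lambda>l. cis (- (t * of_int l))) o\<^sub>L diag_op (\<lambda>l. cis (t * of_int l))) o\<^sub>L b o\<^sub>L
      (diag_op (\<lambda>l. cis (- (t * of_int l))) o\<^sub>L diag_op (\<lambda>l. cis (t * of_int l)))"
      by (intro blinfun_eqI) (simp add: rho_def)
    then show ?thesis by (simp only: one) (auto intro: blinfun_eqI)
  qed
  from this[of \<theta>] this[of "- \<theta>"] show ?thesis
    by (intro inv_equality) auto
qed

text \<open>The commutator of the unbounded operator \<open>V\<^sup>n \<L>\<close> with \<open>a\<close>; it is meaningful on the span of
  the \<open>E\<^sub>l\<close> when \<open>a\<close> preserves that span.\<close>

definition commutator_VL :: "int \<Rightarrow> ell2_op \<Rightarrow> ell2 \<Rightarrow> ell2" where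
  "commutator_VL n a f =
    V_pow n (mult_seq of_int (a f)) - a (V_pow n (mult_seq of_int f))"

definition bounded_extension :: "(ell2 \<Rightarrow> ell2) \<Rightarrow> ell2_op \<Rightarrow> bool" where
  "bounded_extension D T \<longleftrightarrow> clinear_op T \<and> (\<forall>f\<in>ell2c.span (range E). T f = D f)"

text \<open>\<open>\<delta> a = C [V\<^sup>n \<L>, a] + \<delta>' a\<close> for all \<open>a\<close>, including that the commutator has a bounded
  extension (which is unique, as the span of the \<open>E\<^sub>l\<close> is dense).\<close>

definition decomposes ::
  "supernatural \<Rightarrow> int \<Rightarrow> (ell2_op \<Rightarrow> ell2_op) \<Rightarrow> complex \<Rightarrow> (ell2_op \<Rightarrow> ell2_op) \<Rightarrow> bool" where
  "decomposes N n \<delta> C \<delta>' \<longleftrightarrow> (\<forall>a\<in>BD_alg N. \<exists>T.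
    bounded_extension (commutator_VL n a) T \<and> \<delta> a = cscale_op C T + \<delta>' a)"

end

theory Submission
  imports Defs
begin

text \<open>Covariance forces \<open>\<delta> b = V\<^sup>n d\<^sub>b(\<L>)\<close> for diagonal \<open>b\<close> and \<open>\<delta> V = V\<^bsup>n+1\<^esup> c(\<L>)\<close>, where \<open>c\<close> is a
  uniform limit of sequences with periods dividing \<open>N\<close>. Since diagonal operators commute,
  \<open>d\<^sub>a(l) (b(l) - b(l+n)) = d\<^sub>b(l) (a(l) - a(l+n))\<close>. If some \<open>j\<close> dividing \<open>N\<close> does not divide \<open>n\<close>, the
  choice \<open>a(l) = exp (2 \<pi> i l / j)\<close> makes \<open>a(l) - a(l+n)\<close> invertible, and \<open>\<delta>\<close> is implemented by
  \<open>V\<^sup>n \<beta>(\<L>)\<close> with \<open>\<beta> = d\<^sub>a / (a - a(\<cdot>+n))\<close>. Otherwise \<open>V\<^sup>n\<close> commutes with the diagonal, \<open>\<delta>\<close> vanishes on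
  it, and one has to solve \<open>\<beta>(l+1) - \<beta>(l) = c(l) - C\<close>: for periodic \<open>c\<close> this has a periodic solution
  exactly when \<open>C\<close> is the mean of \<open>c\<close>; in general \<open>c\<close> is approximated by periodic sequences, whose
  means converge along a subsequence.\<close>

section \<open>Matrix entries and adjoints\<close>

text \<open>The case distinction in the theorem is a single question: does every \<open>j\<close>
  dividing \<open>N\<close> divide \<open>n\<close>? For finite \<open>N\<close> it is enough to
  test \<open>sn_value N\<close>; an infinite \<open>N\<close> has arbitrarily large divisors, so
  only \<open>n = 0\<close> passes. The obstacle is that \<open>BD N\<close> is a hull: its elements
  are known only through closed star-subalgebras that contain the generators. The regularity of
  \<open>c\<close> is therefore read off from one such subalgebra, chosen as an upper bound for
  \<open>BD N\<close>. The two exceptional cases differ in what survives the approximation. For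
  finite \<open>N\<close> the number \<open>sn_value N\<close> is itself an admissible period and a
  multiple of all others, so \<open>c\<close> is exactly periodic and has an exact primitive. For
  infinite \<open>N\<close> only the increments of the primitives are controlled, not their size;
  commutators converge although the operators need not, which is the source of approximate
  innerness. Since the index operator is unbounded, a bounded extension of its commutator has to be
  produced for every \<open>a\<close>; it is constructed in the same induction over generators that
  carries the limits.\<close>

definition entry :: "ell2_op \<Rightarrow> int \<Rightarrow> int \<Rightarrow> complex" where
  "entry A k l = coord (A (E l)) k"

lemma coord_E: "coord (E l) k = (if k = l then 1 else 0)"
  by (simp add: E.rep_eq)

lemma norm_coord_le: "cmod (coord f k) \<le> norm f"
proof (rule power2_le_imp_le)
  have "(cmod (coord f k))\<^sup>2 = (\<Sum>\<^sub>\<infinity>l\<in>{k}. (cmod (coord f l))\<^sup>2)" by simp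
  also have "\<dots> \<le> (\<Sum>\<^sub>\<infinity>l. (cmod (coord f l))\<^sup>2)"
    by (rule infsum_mono_neutral) (auto simp: coord_summable)
  finally show "(cmod (coord f k))\<^sup>2 \<le> (norm f)\<^sup>2" by (simp add: norm_ell2_sq)
qed simp

lemma norm_E: "norm (E l) = 1"
proof -
  have "(norm (E l))\<^sup>2 = (\<Sum>\<^sub>\<infinity>k. (cmod (coord (E l) k))\<^sup>2)" by (rule norm_ell2_sq)
  also have "\<dots> = (\<Sum>\<^sub>\<infinity>k\<in>{l}. (cmod (coord (E l) k))\<^sup>2)"
    by (rule infsum_cong_neutral) (auto simp: coord_E)
  also have "\<dots> = 1" by (simp add: coord_E)
  finally show ?thesis by (simp add: power2_eq_1_iff) (smt (verit) norm_ge_zero)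
qed

lemma norm_entry_le: "cmod (entry A k l) \<le> norm A"
  using norm_coord_le[of "A (E l)" k] norm_blinfun[of A "E l"] by (simp add: entry_def norm_E)

lemma coord_add: "coord (f + g) l = coord f l + coord g l"
  by (simp add: plus_ell2.rep_eq)

lemma coord_diff: "coord (f - g) l = coord f l - coord g l"
  by (simp add: minus_ell2.rep_eq)

lemma coord_minus: "coord (- f) l = - coord f l"
  by (simp add: uminus_ell2.rep_eq)

lemma coord_zero: "coord 0 l = 0"
  by (simp add: zero_ell2.rep_eq)

lemma coord_cscale: "coord (cscale c f) l = c * coord f l"
  by (simp add: cscale.rep_eq)

lemmas coord_simps = coord_add coord_diff coord_minus coord_zero coord_cscale coord_E V_pow_coord

lemma coord_sum: "coord (sum f F) l = (\<Sum>i\<in>F. coord (f i) l)"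
  by (induction F rule: infinite_finite_induct) (auto simp: coord_simps)

text \<open>The squared error is the tail, outside \<open>F\<close>, of the convergent sum of
  squares.\<close>

lemma finite_support_approx:
  assumes "0 < e"
  obtains F where "finite F" "norm (f - (\<Sum>l\<in>F. cscale (coord f l) (E l))) < e"
proof -
  let ?q = "\<lambda>l. (cmod (coord f l))\<^sup>2"
  have "(?q has_sum infsum ?q UNIV) UNIV"
    using coord_summable by (rule has_sum_infsum)
  then have "\<forall>\<^sub>F F in finite_subsets_at_top UNIV. dist (sum ?q F) (infsum ?q UNIV) < e\<^sup>2"
    unfolding has_sum_def using assms by (intro tendstoD) auto
  then obtain F where F: "finite F" "dist (sum ?q F) (infsum ?q UNIV) < e\<^sup>2"
    unfolding eventually_finite_subsets_at_top by auto
  let ?g = "\<Sum>l\<in>F. cscale (coord f l) (E l)"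
  have g: "coord ?g k = (if k \<in> F then coord f k else 0)" for k
    by (simp add: coord_sum coord_simps if_distrib[of "\<lambda>x. _ * x"] sum.delta'[OF F(1)] F(1) cong: if_cong)
  have "(norm (f - ?g))\<^sup>2 = infsum ?q (UNIV - F)"
    unfolding norm_ell2_sq by (rule infsum_cong_neutral) (auto simp: coord_diff g)
  also have "\<dots> = infsum ?q UNIV - infsum ?q F"
    by (rule infsum_Diff) (auto simp: coord_summable F)
  also have "\<dots> < e\<^sup>2" using F by (simp add: dist_real_def abs_if split: if_splits)
  finally have "norm (f - ?g) < e" using assms power2_less_imp_less by fastforce
  with F(1) show thesis by (rule that)
qed

section \<open>Complex linearity and recovery of operators from their entries\<close>

lemma clinear_opD: "clinear_op A \<Longrightarrow> A (cscale c f) = cscale c (A f)"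
  by (simp add: clinear_op_def)

lemma clinear_zero: "clinear_op 0"
  by (simp add: clinear_op_def)
lemma clinear_add: "clinear_op A \<Longrightarrow> clinear_op B \<Longrightarrow> clinear_op (A + B)"
  by (simp add: clinear_op_def blinfun.add_left ell2c.scale_right_distrib)
lemma clinear_diff: "clinear_op A \<Longrightarrow> clinear_op B \<Longrightarrow> clinear_op (A - B)"
  by (simp add: clinear_op_def blinfun.diff_left ell2c.scale_right_diff_distrib)
lemma clinear_scale: "clinear_op A \<Longrightarrow> clinear_op (cscale_op c A)"
  by (simp add: clinear_op_def ell2c.scale_left_commute)
lemma clinear_compose: "clinear_op A \<Longrightarrow> clinear_op B \<Longrightarrow> clinear_op (A o\<^sub>L B)"
  by (simp add: clinear_op_def)
lemma clinear_V_pow: "clinear_op (V_pow n)"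
  by (auto simp: clinear_op_def intro!: ell2_eqI simp: coord_simps)
lemma clinear_diag: "bounded (range b) \<Longrightarrow> clinear_op (diag_op b)"
  by (auto simp: clinear_op_def intro!: ell2_eqI simp: coord_simps diag_op_coord)

lemmas clinear_intros = clinear_zero clinear_add clinear_diff clinear_scale clinear_compose
  clinear_V_pow clinear_diag

text \<open>Complex linearity matters: \<open>ell2_op\<close> guarantees only real linearity, which
  says nothing about the value at \<open>i\<close> times a basis vector. With it the difference
  vanishes on the dense set of finite combinations of the \<open>E l\<close>, and boundedness does
  the rest.\<close>

lemma clinear_op_eqI:
  assumes "clinear_op A" "clinear_op B" "\<And>k l. entry A k l = entry B k l"
  shows "A = B"
proof (rule blinfun_eqI)
  fix f
  let ?D = "A - B"
  have DE: "?D (E l) = 0" for l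
    using assms(3) by (intro ell2_eqI) (simp add: blinfun.diff_left coord_simps entry_def)
  have cD: "clinear_op ?D" using assms by (intro clinear_intros)
  have "norm (?D f) \<le> e" if "0 < e" for e
  proof -
    define d where "d = e / (norm ?D + 1)"
    have N: "norm ?D + 1 > 0" using norm_ge_zero[of ?D] by linarith
    then have "0 < d" using that by (simp add: d_def)
    then obtain F where F: "finite F" "norm (f - (\<Sum>l\<in>F. cscale (coord f l) (E l))) < d"
      by (rule finite_support_approx)
    let ?g = "\<Sum>l\<in>F. cscale (coord f l) (E l)"
    have "?D ?g = 0"
      by (simp only: blinfun.sum_right clinear_opD[OF cD] DE) simp
    then have "?D f = ?D (f - ?g)" by (simp add: blinfun.diff_right)
    then have "norm (?D f) = norm (?D (f - ?g))" by (rule arg_cong[where f = norm])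
    also have "\<dots> \<le> norm ?D * norm (f - ?g)" by (rule norm_blinfun)
    also have "\<dots> \<le> (norm ?D + 1) * d" using F(2) by (intro mult_mono) auto
    also have "\<dots> = e" using N by (simp add: d_def)
    finally show ?thesis .
  qed
  then have "norm (?D f) \<le> 0"
    by (rule field_le_epsilon[where y = "0::real", simplified])
  then show "A f = B f" by (simp add: blinfun.diff_left)
qed

lemma entry_add: "entry (A + B) k l = entry A k l + entry B k l"
  by (simp add: entry_def blinfun.add_left coord_simps)
lemma entry_diff: "entry (A - B) k l = entry A k l - entry B k l"
  by (simp add: entry_def blinfun.diff_left coord_simps)
lemma entry_minus: "entry (- A) k l = - entry A k l"
  by (simp add: entry_def blinfun.minus_left coord_simps)
lemma entry_scale: "entry (cscale_op c A) k l = c * entry A k l"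
  by (simp add: entry_def coord_simps)
lemma V_pow_E: "V_pow n (E l) = E (l + n)"
  by (rule ell2_eqI) (auto simp: coord_simps)
lemma entry_V_left: "entry (V_pow n o\<^sub>L A) k l = entry A (k - n) l"
  by (simp add: entry_def coord_simps)
lemma entry_V_right: "entry (A o\<^sub>L V_pow n) k l = entry A k (l + n)"
  by (simp add: entry_def V_pow_E)
lemma entry_V: "entry (V_pow n) k l = (if k = l + n then 1 else 0)"
  by (simp add: entry_def V_pow_E coord_simps)
lemma entry_diag_left: "bounded (range b) \<Longrightarrow> entry (diag_op b o\<^sub>L A) k l = b k * entry A k l"
  by (simp add: entry_def diag_op_coord)
lemma entry_diag_right:
  "bounded (range b) \<Longrightarrow> clinear_op A \<Longrightarrow> entry (A o\<^sub>L diag_op b) k l = b l * entry A k l"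
  by (simp add: entry_def diag_op_E clinear_opD coord_simps)
lemma entry_diag: "bounded (range b) \<Longrightarrow> entry (diag_op b) k l = (if k = l then b l else 0)"
  by (auto simp add: entry_def diag_op_coord coord_simps)

lemmas entry_simps = entry_add entry_diff entry_minus entry_scale entry_V_left entry_V_right
  entry_V entry_diag_left entry_diag_right entry_diag

lemma norm_diag_op_le:
  assumes "\<And>l. cmod (b l) \<le> B"
  shows "norm (diag_op b) \<le> B"
proof -
  have bd: "bounded (range b)" using assms by (auto simp: bounded_iff)
  have B0: "0 \<le> B" using assms[of 0] norm_ge_zero order_trans by blast
  have "norm (diag_op b f) \<le> B * norm f" for f
  proof (rule power2_le_imp_le)
    have "(norm (diag_op b f))\<^sup>2 = (\<Sum>\<^sub>\<infinity>l. (cmod (b l * coord f l))\<^sup>2)"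
      by (simp add: norm_ell2_sq diag_op_coord[OF bd])
    also have "\<dots> \<le> (\<Sum>\<^sub>\<infinity>l. B\<^sup>2 * (cmod (coord f l))\<^sup>2)"
      using assms by (intro infsum_mono ell2_scale[OF coord_summable] summable_on_cmult_right
          coord_summable) (auto simp: norm_mult power_mult_distrib mult_right_mono power_mono)
    also have "\<dots> = (B * norm f)\<^sup>2"
      by (simp add: infsum_cmult_right' norm_ell2_sq power_mult_distrib)
    finally show "(norm (diag_op b f))\<^sup>2 \<le> (B * norm f)\<^sup>2" .
  qed (use B0 in simp)
  then show ?thesis using B0 by (intro norm_blinfun_bound)
qed

lemma norm_V_pow_le: "norm (V_pow n) \<le> 1"
proof (rule norm_blinfun_bound)
  fix f
  have "(norm (V_pow n f))\<^sup>2 = (norm f)\<^sup>2"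
    unfolding norm_ell2_sq V_pow_coord
    using infsum_reindex_bij_betw[of "\<lambda>l. l - n" UNIV UNIV "\<lambda>l. (cmod (coord f l))\<^sup>2"]
    by (simp add: bij_betw_def inj_on_def surj_diff_right)
  then show "norm (V_pow n f) \<le> 1 * norm f" by simp
qed simp

text \<open>The real part of the usual adjoint relation. It matches the library inner product and is
  already strong enough for uniqueness and the norm bound of adjoints.\<close>

definition real_adjoint :: "ell2_op \<Rightarrow> ell2_op \<Rightarrow> bool" where
  "real_adjoint A B \<longleftrightarrow> (\<forall>f g. A f \<bullet> g = f \<bullet> B g)"

lemma coord_cnj_summable: "(\<lambda>l. coord f l * cnj (coord g l)) summable_on UNIV"
  by (rule abs_summable_summable) (simp add: norm_mult coord_inner_abs_summable)

lemma Re_cinner: "Re (cinner f g) = f \<bullet> g"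
  unfolding cinner_def inner_ell2_def
  by (subst infsum_Re[symmetric, OF coord_cnj_summable]) (simp add: inner_complex_def)

lemma is_adjoint_imp_real_adjoint: "is_adjoint A B \<Longrightarrow> real_adjoint A B"
  unfolding is_adjoint_def real_adjoint_def by (metis Re_cinner)

lemma real_adjoint_unique: "real_adjoint A B \<Longrightarrow> real_adjoint A B' \<Longrightarrow> B = B'"
  unfolding real_adjoint_def by (intro blinfun_eqI) (metis vector_eq_rdot inner_commute)

lemma real_adjoint_norm_le: 
  assumes "real_adjoint A B" shows "norm B \<le> norm A"
proof (rule norm_blinfun_bound)
  fix g
  have "norm (B g) * norm (B g) = A (B g) \<bullet> g"
    using assms by (metis real_adjoint_def power2_norm_eq_inner power2_eq_square)
  also have "\<dots> \<le> norm (A (B g)) * norm g" by (rule norm_cauchy_schwarz)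
  also have "\<dots> \<le> norm A * norm (B g) * norm g" by (intro mult_right_mono norm_blinfun) auto
  finally have "norm (B g) * norm (B g) \<le> norm (B g) * (norm A * norm g)" by (simp add: mult_ac)
  then show "norm (B g) \<le> norm A * norm g"
    by (cases "norm (B g) = 0") auto
qed simp

lemma is_adjoint_V_pow: "is_adjoint (V_pow n) (V_pow (- n))"
  unfolding is_adjoint_def
proof (intro allI)
  fix f g
  show "cinner (V_pow n f) g = cinner f (V_pow (- n) g)"
    unfolding cinner_def V_pow_coord
    using infsum_reindex_bij_betw[of "\<lambda>l. l - n" UNIV UNIV "\<lambda>l. coord f l * cnj (coord g (l + n))"]
    by (simp add: bij_betw_def inj_on_def surj_diff_right)
qed

lemmas real_adjoint_V_pow = is_adjoint_V_pow[THEN is_adjoint_imp_real_adjoint]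

lemma real_adjoint_diag:
  assumes "bounded (range b)"
  shows "real_adjoint (diag_op b) (diag_op (\<lambda>l. cnj (b l)))"
proof -
  have "bounded (range (\<lambda>l. cnj (b l)))" using assms by (auto simp: bounded_iff)
  then show ?thesis
    unfolding real_adjoint_def inner_ell2_def
    by (simp add: diag_op_coord assms inner_complex_def algebra_simps)
qed

lemma real_adjoint_add: "real_adjoint A B \<Longrightarrow> real_adjoint A' B' \<Longrightarrow> real_adjoint (A + A') (B + B')"
  by (simp add: real_adjoint_def blinfun.add_left inner_add_left inner_add_right)
lemma real_adjoint_diff: "real_adjoint A B \<Longrightarrow> real_adjoint A' B' \<Longrightarrow> real_adjoint (A - A') (B - B')"
  by (simp add: real_adjoint_def blinfun.diff_left inner_diff_left inner_diff_right)
lemma real_adjoint_compose: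
  "real_adjoint A B \<Longrightarrow> real_adjoint A' B' \<Longrightarrow> real_adjoint (A o\<^sub>L A') (B' o\<^sub>L B)"
  by (simp add: real_adjoint_def)
lemma real_adjoint_scale:
  assumes "real_adjoint A B" "clinear_op B"
  shows "real_adjoint (cscale_op c A) (cscale_op (cnj c) B)"
proof -
  have "cscale c f \<bullet> g = f \<bullet> cscale (cnj c) g" for f g
    unfolding inner_ell2_def by (simp add: coord_simps inner_complex_def algebra_simps)
  then show ?thesis using assms by (simp add: real_adjoint_def clinear_op_def)
qed

section \<open>Supernatural numbers and almost periodicity\<close>

lemma sn_divides_1: "sn_divides 1 N"
  by (simp add: sn_divides_def flip: zero_enat_def)

lemma sn_divides_pos: "sn_divides j N \<Longrightarrow> 0 < j"
  by (simp add: sn_divides_def)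

lemma sn_divides_lcm:
  assumes "sn_divides i N" "sn_divides j N"
  shows "sn_divides (lcm i j) N"
  using assms by (auto simp: sn_divides_def multiplicity_lcm max_def lcm_pos_nat)

lemma multiplicity_sn_value:
  assumes "sn_finite N" "prime p"
  shows "enat (multiplicity p (sn_value N)) = N p" 
proof -
  have fin: "finite {p. prime p \<and> N p \<noteq> 0}" and ni: "\<And>p. prime p \<Longrightarrow> N p \<noteq> \<infinity>"
    using assms(1) sn_finite_iff by auto
  have "multiplicity p (sn_value N) = (if p \<in> {p. prime p \<and> N p \<noteq> 0} then the_enat (N p) else 0)"
    unfolding sn_value_def
    by (subst multiplicity_prod_prime_powers) (use fin assms in auto)
  then show ?thesis using assms(2) ni[OF assms(2)] by (auto simp: zero_enat_def)
qed

lemma sn_value_pos: "0 < sn_value N"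
  unfolding sn_value_def by (intro prod_pos) (auto simp: prime_gt_0_nat)

lemma sn_divides_sn_value: "sn_finite N \<Longrightarrow> sn_divides (sn_value N) N"
  by (simp add: sn_divides_def sn_value_pos multiplicity_sn_value)

lemma sn_divides_imp_dvd_sn_value:
  assumes "sn_finite N" "sn_divides j N" 
  shows "j dvd sn_value N"
proof (rule multiplicity_le_imp_dvd)
  show "j \<noteq> 0" using sn_divides_pos[OF assms(2)] by simp
  fix p :: nat assume "prime p"
  then have "enat (multiplicity p j) \<le> enat (multiplicity p (sn_value N))"
    using assms by (simp add: multiplicity_sn_value sn_divides_def)
  then show "multiplicity p j \<le> multiplicity p (sn_value N)" by simp
qed

text \<open>Either a single prime has infinite exponent and all its powers divide \<open>N\<close>,
  or infinitely many primes divide \<open>N\<close> and a large one can be taken.\<close>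

lemma sn_infinite_divides_large:
  assumes "\<not> sn_finite N"
  shows "\<exists>j. sn_divides j N \<and> m < j"
proof (cases "finite {p. prime p \<and> N p \<noteq> 0}")
  case True
  then obtain p where p: "prime p" "N p = \<infinity>" using assms by (auto simp: sn_finite_iff)
  have "enat (multiplicity q (p ^ m)) \<le> N q" if "prime q" for q
    using p that by (cases "q = p") (auto simp: multiplicity_distinct_prime_power simp flip: zero_enat_def)
  then have "sn_divides (p ^ m) N" using p by (auto simp: sn_divides_def prime_gt_0_nat)
  moreover have "m < p ^ m" by (rule power_gt_expt[OF prime_gt_Suc_0_nat[OF p(1)]])
  ultimately show ?thesis by blast
next
  case False
  then obtain p where p: "prime p" "N p \<noteq> 0" "m < p"
    unfolding infinite_nat_iff_unbounded by blast
  have "enat (multiplicity q p) \<le> N q" if "prime q" for q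
    using p that by (cases "q = p"; cases "N p")
      (auto simp: prime_multiplicity_other enat_0_iff simp flip: zero_enat_def)
  then have "sn_divides p N" using p by (auto simp: sn_divides_def prime_gt_0_nat)
  with p(3) show ?thesis by blast
qed

section \<open>Sequences with a period dividing \<open>N\<close>, and the algebra they
  generate\<close>

definition sn_periodic :: "supernatural \<Rightarrow> (int \<Rightarrow> complex) \<Rightarrow> bool" where
  "sn_periodic N b \<longleftrightarrow> (\<exists>j. sn_divides j N \<and> (\<forall>l. b (l + int j) = b l))"

lemma Bdiag_eq: "Bdiag N = {diag_op b | b. sn_periodic N b}"
  by (simp add: Bdiag_def sn_periodic_def)

lemma periodic_mult:
  fixes b :: "int \<Rightarrow> 'a"
  assumes "\<And>l. b (l + j) = b l"
  shows "b (l + j * k) = b l"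
proof (induction k rule: int_induct[where k = 0])
  case (step1 i)
  then show ?case using assms[of "l + j * i"] by (simp add: algebra_simps)
next
  case (step2 i)
  then show ?case using assms[of "l + j * (i - 1)"] by (simp add: algebra_simps)
qed simp

lemma periodic_mod:
  fixes b :: "int \<Rightarrow> 'a"
  assumes "\<And>l. b (l + j) = b l"
  shows "b l = b (l mod j)"
  using periodic_mult[of b j, OF assms, of "l mod j" "l div j"] by (simp add: add.commute)

lemma sn_periodic_bounded: 
  assumes "sn_periodic N b"
  shows "bounded (range b)"
proof -
  obtain j where j: "sn_divides j N" "\<And>l. b (l + int j) = b l"
    using assms by (auto simp: sn_periodic_def)
  have "b l \<in> b ` {0..<int j}" for l
    using periodic_mod[of b "int j" l, OF j(2)] sn_divides_pos[OF j(1)] by (intro image_eqI[of _ _ "l mod int j"]) auto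
  then have "range b \<subseteq> b ` {0..<int j}" by auto
  then show ?thesis by (meson bounded_subset finite_imp_bounded finite_imageI finite_atLeastLessThan_int)
qed

lemma sn_periodic_cnj: "sn_periodic N b \<Longrightarrow> sn_periodic N (\<lambda>l. cnj (b l))"
  by (auto simp: sn_periodic_def)

text \<open>Gives \<open>BD_alg N\<close>, defined as a hull, an induction principle. No rule for
  adjoints occurs because the generating set is already closed under them.\<close>

inductive_set generated_alg :: "supernatural \<Rightarrow> ell2_op set" for N where
  V: "V \<in> generated_alg N"
| V_inv: "V_pow (- 1) \<in> generated_alg N"
| diag: "sn_periodic N b \<Longrightarrow> diag_op b \<in> generated_alg N"
| add: "A \<in> generated_alg N \<Longrightarrow> B \<in> generated_alg N \<Longrightarrow> A + B \<in> generated_alg N"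
| scale: "A \<in> generated_alg N \<Longrightarrow> cscale_op c A \<in> generated_alg N"
| compose: "A \<in> generated_alg N \<Longrightarrow> B \<in> generated_alg N \<Longrightarrow> A o\<^sub>L B \<in> generated_alg N"

lemma generated_alg_clinear: "A \<in> generated_alg N \<Longrightarrow> clinear_op A"
  by (induction rule: generated_alg.induct) (auto intro!: clinear_intros sn_periodic_bounded)

text \<open>An adjoint is assembled along the construction of \<open>A\<close>; by
  \<open>real_adjoint_unique\<close>, any adjoint that \<open>star_subalgebra\<close> asks for is
  this one.\<close>

lemma generated_alg_adjoint: "A \<in> generated_alg N \<Longrightarrow> \<exists>B\<in>generated_alg N. real_adjoint A B"
proof (induction rule: generated_alg.induct)
  case V then show ?case using real_adjoint_V_pow[of 1] generated_alg.V_inv by auto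
next
  case V_inv then show ?case using real_adjoint_V_pow[of "-1"] generated_alg.V by auto
next
  case (diag b)
  then show ?case
    by (meson real_adjoint_diag sn_periodic_bounded sn_periodic_cnj generated_alg.diag)
next
  case (add A B) then show ?case by (meson real_adjoint_add generated_alg.add)
next
  case (scale A c)
  then show ?case by (meson real_adjoint_scale generated_alg_clinear generated_alg.scale)
next
  case (compose A B) then show ?case by (meson real_adjoint_compose generated_alg.compose)
qed

lemma cscale_op_0 [simp]: "cscale_op 0 A = 0"
  by (rule blinfun_eqI) simp

lemma star_subalgebra_generated_alg: "star_subalgebra (generated_alg N)"
  unfolding star_subalgebra_def
proof (intro conjI ballI allI impI)
  show "0 \<in> generated_alg N"
    using generated_alg.scale[OF generated_alg.V, of 0 N] by simp
  fix A B assume A: "A \<in> generated_alg N"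
  show "B \<in> generated_alg N" if "clinear_op B \<and> is_adjoint A B"
    using that generated_alg_adjoint[OF A] is_adjoint_imp_real_adjoint real_adjoint_unique by metis
qed (auto intro: generated_alg.intros generated_alg_clinear)

lemma star_subalgebraD:
  assumes "star_subalgebra S"
  shows "\<forall>A\<in>S. clinear_op A" "\<forall>A\<in>S. \<forall>B\<in>S. A + B \<in> S" "\<forall>c. \<forall>A\<in>S. cscale_op c A \<in> S"
    "\<forall>A\<in>S. \<forall>B\<in>S. A o\<^sub>L B \<in> S"
    "\<forall>A\<in>S. \<forall>B. clinear_op B \<and> is_adjoint A B \<longrightarrow> B \<in> S"
  using assms unfolding star_subalgebra_def by - (elim conjE, assumption)+

lemma BD_alg_eq: "BD_alg N = generated_alg N"
  unfolding BD_alg_def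
proof (rule hull_unique)
  show "{V, V_pow (- 1)} \<union> Bdiag N \<subseteq> generated_alg N"
    by (auto simp: Bdiag_eq intro: generated_alg.intros)
  fix S assume S: "{V, V_pow (- 1)} \<union> Bdiag N \<subseteq> S" "star_subalgebra S"
  have closed: "\<And>A B. A \<in> S \<Longrightarrow> B \<in> S \<Longrightarrow> A + B \<in> S" "\<And>c A. A \<in> S \<Longrightarrow> cscale_op c A \<in> S"
    "\<And>A B. A \<in> S \<Longrightarrow> B \<in> S \<Longrightarrow> A o\<^sub>L B \<in> S"
    using star_subalgebraD[OF S(2)] by blast+
  show "generated_alg N \<subseteq> S"
  proof
    fix A assume "A \<in> generated_alg N"
    then show "A \<in> S"
    proof (induction rule: generated_alg.induct)
      case (diag b)
      then show ?case using S(1) by (auto simp: Bdiag_eq)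
    qed (use S(1) closed in auto)
  qed
qed (rule star_subalgebra_generated_alg)

text \<open>Translates of an operator, \<open>V\<^sup>k A V\<^sup>-\<^sup>k\<close>: almost invariance under \<open>k \<in> j\<int>\<close> with
  \<open>j\<close> dividing \<open>N\<close> defines a closed star-subalgebra without reference to Fourier series.\<close>

definition translate :: "int \<Rightarrow> ell2_op \<Rightarrow> ell2_op" where
  "translate k A = V_pow k o\<^sub>L A o\<^sub>L V_pow (- k)"

lemma V_pow_inverse: "V_pow (- k) o\<^sub>L V_pow k = id_blinfun" "V_pow k o\<^sub>L V_pow (- k) = id_blinfun"
  by (simp_all flip: V_pow_add add: V_pow_0)

lemma blinfun_compose_id [simp]: "A o\<^sub>L id_blinfun = A" "id_blinfun o\<^sub>L A = A"
  by (auto intro: blinfun_eqI)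

lemma blinfun_compose_assoc: "(A o\<^sub>L B) o\<^sub>L C = A o\<^sub>L (B o\<^sub>L C)"
  by (rule blinfun_eqI) simp

lemma V_pow_cancel: "V_pow (- k) (V_pow k f) = f" "V_pow k (V_pow (- k) f) = f"
  using V_pow_inverse[of k] by (metis blinfun_apply_blinfun_compose blinfun_apply_id_blinfun)+

lemma translate_compose: "translate k (A o\<^sub>L B) = translate k A o\<^sub>L translate k B"
  by (rule blinfun_eqI) (simp add: translate_def V_pow_cancel)

lemma translate_add: "translate k (A + B) = translate k A + translate k B"
  by (rule blinfun_eqI) (simp add: translate_def blinfun.add_left blinfun.add_right)

lemma translate_diff: "translate k (A - B) = translate k A - translate k B"
  by (rule blinfun_eqI) (simp add: translate_def blinfun.diff_left blinfun.diff_right)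

lemma translate_scale: "translate k (cscale_op c A) = cscale_op c (translate k A)"
  by (rule blinfun_eqI) (simp add: translate_def clinear_opD[OF clinear_V_pow])

lemma norm_translate_le: "norm (translate k A) \<le> norm A"
proof -
  have "norm (translate k A) \<le> (norm (V_pow k) * norm A) * norm (V_pow (- k))"
    unfolding translate_def
    by (intro order_trans[OF norm_blinfun_compose] mult_right_mono norm_blinfun_compose) auto
  also have "\<dots> \<le> (1 * norm A) * 1"
    by (intro mult_mono norm_V_pow_le) auto
  finally show ?thesis by simp
qed

lemma real_adjoint_translate:
  assumes "real_adjoint A B" shows "real_adjoint (translate k A) (translate k B)"
  using real_adjoint_compose[OF real_adjoint_compose[OF real_adjoint_V_pow[of k] assms]
      real_adjoint_V_pow[of "- k"]]
  by (simp add: translate_def blinfun_compose_assoc)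

lemma entry_translate: "entry (translate k A) i l = entry A (i - k) (l - k)"
  by (simp add: translate_def entry_simps blinfun_compose_assoc)

lemma norm_cscale_op_le: "norm (cscale_op c A) \<le> cmod c * norm A"
  by (rule norm_blinfun_bound)
    (auto simp: cscale_norm mult.assoc intro!: mult_left_mono norm_blinfun)

definition almost_periodic_ops :: "supernatural \<Rightarrow> ell2_op set" where
  "almost_periodic_ops N = {A. clinear_op A \<and>
    (\<forall>e>0. \<exists>j. sn_divides j N \<and> (\<forall>k. norm (translate (int j * k) A - A) \<le> e))}"

lemma almost_periodic_opsD:
  assumes "A \<in> almost_periodic_ops N" "0 < e"
  shows "\<exists>j. sn_divides j N \<and> (\<forall>k. norm (translate (int j * k) A - A) \<le> e)"
  using assms by (auto simp: almost_periodic_ops_def)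

lemma closed_clinear: "closed {A. clinear_op A}"
proof -
  have "closed {A :: ell2_op. A (cscale c f) = cscale c (A f)}" for c f
    by (intro closed_Collect_eq continuous_intros
        bounded_linear.continuous_on[OF bounded_linear_cscale])
  then show ?thesis unfolding clinear_op_def by (intro closed_Collect_all)
qed

lemma closed_almost_periodic_ops: "closed (almost_periodic_ops N)"
proof -
  have "A \<in> almost_periodic_ops N" if lim: "X \<longlonglongrightarrow> A" and X: "\<And>n. X n \<in> almost_periodic_ops N" for X A
    unfolding almost_periodic_ops_def
  proof (intro CollectI conjI allI impI)
    show "clinear_op A"
      using closed_sequentially[OF closed_clinear _ lim] X by (auto simp: almost_periodic_ops_def)
    fix e :: real assume "0 < e"
    then obtain n where n: "norm (X n - A) < e / 3"
      using LIMSEQ_D[OF lim, of "e / 3"] by auto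
    obtain j where j: "sn_divides j N" "\<And>k. norm (translate (int j * k) (X n) - X n) \<le> e / 3"
      using almost_periodic_opsD[OF X[of n], of "e / 3"] \<open>0 < e\<close> by auto
    have "norm (translate (int j * k) A - A) \<le> e" for k
    proof -
      have "translate (int j * k) A - A = (X n - A) - translate (int j * k) (X n - A)
          + (translate (int j * k) (X n) - X n)"
        by (simp add: translate_diff)
      also have "norm \<dots> \<le> (norm (X n - A) + norm (X n - A)) + e / 3"
        by (intro order_trans[OF norm_triangle_ineq] add_mono j order_trans[OF norm_triangle_ineq4]
            norm_translate_le order_refl)
      finally show ?thesis using n by simp
    qed
    with j(1) show "\<exists>j. sn_divides j N \<and> (\<forall>k. norm (translate (int j * k) A - A) \<le> e)" by blast
  qed
  then show ?thesis by (auto simp: closed_sequential_limits)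
qed

text \<open>The lcm of two divisors still divides \<open>N\<close>, and since the estimates hold for
  all \<open>k\<close>, they survive when a divisor is replaced by a multiple.\<close>

lemma almost_periodic_ops_common:
  assumes "A \<in> almost_periodic_ops N" "B \<in> almost_periodic_ops N" "0 < e" "0 < e'"
  shows "\<exists>j. sn_divides j N \<and> (\<forall>k. norm (translate (int j * k) A - A) \<le> e) \<and>
    (\<forall>k. norm (translate (int j * k) B - B) \<le> e')"
proof -
  obtain i where i: "sn_divides i N" "\<And>k. norm (translate (int i * k) A - A) \<le> e"
    using almost_periodic_opsD[OF assms(1,3)] by blast
  obtain j where j: "sn_divides j N" "\<And>k. norm (translate (int j * k) B - B) \<le> e'"
    using almost_periodic_opsD[OF assms(2,4)] by blast
  obtain r where r: "lcm i j = i * r" by (rule dvdE[OF dvd_lcm1])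
  obtain s where s: "lcm i j = j * s" by (rule dvdE[OF dvd_lcm2])
  show ?thesis
  proof (intro exI conjI allI)
    show "sn_divides (lcm i j) N" by (rule sn_divides_lcm[OF i(1) j(1)])
    show "norm (translate (int (lcm i j) * k) A - A) \<le> e" for k
      using i(2)[of "int r * k"] by (simp add: r mult.assoc)
    show "norm (translate (int (lcm i j) * k) B - B) \<le> e'" for k
      using j(2)[of "int s * k"] by (simp add: s mult.assoc)
  qed
qed

lemma star_subalgebra_almost_periodic_ops: "star_subalgebra (almost_periodic_ops N)"
  unfolding star_subalgebra_def
proof (intro conjI ballI allI impI)
  show "0 \<in> almost_periodic_ops N"
    using sn_divides_1[of N]
    by (auto simp: almost_periodic_ops_def clinear_zero translate_def intro!: exI[of _ "1::nat"])
  show "clinear_op A" if "A \<in> almost_periodic_ops N" for A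
    using that by (simp add: almost_periodic_ops_def)
next
  fix A B assume A: "A \<in> almost_periodic_ops N" and B: "B \<in> almost_periodic_ops N"
  have cl: "clinear_op A" "clinear_op B" using A B by (auto simp: almost_periodic_ops_def)
  have "\<exists>j. sn_divides j N \<and> (\<forall>k. norm (translate (int j * k) (A + B) - (A + B)) \<le> e)" if "0 < e" for e
  proof -
    obtain j where j: "sn_divides j N" "\<And>k. norm (translate (int j * k) A - A) \<le> e / 2"
      "\<And>k. norm (translate (int j * k) B - B) \<le> e / 2"
      using almost_periodic_ops_common[OF A B half_gt_zero[OF \<open>0 < e\<close>] half_gt_zero[OF \<open>0 < e\<close>]] by blast
    have "norm (translate (int j * k) (A + B) - (A + B)) \<le> e" for k
      using norm_triangle_mono[OF j(2)[of k] j(3)[of k]] by (simp add: translate_add algebra_simps)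
    with j(1) show ?thesis by blast
  qed
  then show "A + B \<in> almost_periodic_ops N"
    using cl by (simp add: almost_periodic_ops_def clinear_intros)
  have "\<exists>j. sn_divides j N \<and> (\<forall>k. norm (translate (int j * k) (A o\<^sub>L B) - (A o\<^sub>L B)) \<le> e)" if "0 < e" for e
  proof -
    define d where "d = e / (norm A + norm B + 1)"
    have P: "0 < norm A + norm B + 1" using norm_ge_zero[of A] norm_ge_zero[of B] by linarith
    have d: "0 < d" "d * (norm A + norm B) \<le> e"
      using that P by (auto simp: d_def divide_simps algebra_simps)
    obtain j where j: "sn_divides j N" "\<And>k. norm (translate (int j * k) A - A) \<le> d"
      "\<And>k. norm (translate (int j * k) B - B) \<le> d"
      using almost_periodic_ops_common[OF A B d(1) d(1)] by blast
    have "norm (translate (int j * k) (A o\<^sub>L B) - (A o\<^sub>L B)) \<le> e" for k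
    proof -
      let ?t = "translate (int j * k)"
      have "?t (A o\<^sub>L B) - (A o\<^sub>L B) = (?t A o\<^sub>L (?t B - B)) + ((?t A - A) o\<^sub>L B)"
        by (rule blinfun_eqI) (simp add: translate_compose blinfun.bilinear_simps)
      also have "norm \<dots> \<le> norm A * d + d * norm B"
        by (intro order_trans[OF norm_triangle_ineq] add_mono order_trans[OF norm_blinfun_compose]
            mult_mono j norm_translate_le) (use d(1) in auto)
      also have "\<dots> \<le> e" using d(2) by (simp add: algebra_simps)
      finally show ?thesis .
    qed
    with j(1) show ?thesis by blast
  qed
  then show "A o\<^sub>L B \<in> almost_periodic_ops N"
    using cl by (simp add: almost_periodic_ops_def clinear_intros)
next
  fix c A assume A: "A \<in> almost_periodic_ops N"
  have "\<exists>j. sn_divides j N \<and> (\<forall>k. norm (translate (int j * k) (cscale_op c A) - cscale_op c A) \<le> e)"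
    if "0 < e" for e
  proof -
    define d where "d = e / (cmod c + 1)"
    have P: "0 < cmod c + 1" using norm_ge_zero[of c] by linarith
    have d: "0 < d" "cmod c * d \<le> e"
      using that P by (auto simp: d_def divide_simps algebra_simps)
    obtain j where j: "sn_divides j N" "\<And>k. norm (translate (int j * k) A - A) \<le> d"
      using almost_periodic_opsD[OF A d(1)] by blast
    have "norm (translate (int j * k) (cscale_op c A) - cscale_op c A) \<le> e" for k
    proof -
      have "translate (int j * k) (cscale_op c A) - cscale_op c A = cscale_op c (translate (int j * k) A - A)"
        by (rule blinfun_eqI) (simp add: translate_scale blinfun.diff_left ell2c.scale_right_diff_distrib)
      then show ?thesis
        using norm_cscale_op_le[of c "translate (int j * k) A - A"] mult_left_mono[OF j(2)[of k], of "cmod c"] d(2)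
        by simp
    qed
    with j(1) show ?thesis by blast
  qed
  then show "cscale_op c A \<in> almost_periodic_ops N"
    using A by (simp add: almost_periodic_ops_def clinear_intros)
next
  fix A B assume A: "A \<in> almost_periodic_ops N" and B: "clinear_op B \<and> is_adjoint A B"
  then have ad: "real_adjoint A B" by (simp add: is_adjoint_imp_real_adjoint)
  \<comment> \<open>The difference for \<open>B\<close> is the adjoint of the difference for
    \<open>A\<close>, so the same \<open>j\<close> serves both.\<close>
  have "norm (translate k B - B) \<le> norm (translate k A - A)" for k
    by (intro real_adjoint_norm_le real_adjoint_diff real_adjoint_translate ad)
  then show "B \<in> almost_periodic_ops N"
    using A B unfolding almost_periodic_ops_def by (blast intro: order_trans)
qed

text \<open>The generators are exactly invariant: \<open>V\<close> under all translations, a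
  periodic diagonal under multiples of its period. Minimality of the hull extends this, in its
  approximate form, to all of \<open>BD N\<close>.\<close>

lemma BD_subset_almost_periodic_ops: "BD N \<subseteq> almost_periodic_ops N"
  unfolding BD_def
proof (rule hull_minimal)
  have "V \<in> almost_periodic_ops N"
  proof -
    have "translate k V = V" for k
      by (simp add: translate_def flip: V_pow_add)
    then show ?thesis using sn_divides_1[of N]
      by (auto simp: almost_periodic_ops_def clinear_V_pow intro!: exI[of _ "1::nat"])
  qed
  moreover have "diag_op b \<in> almost_periodic_ops N" if b: "sn_periodic N b" for b
  proof -
    obtain j where j: "sn_divides j N" "\<And>l. b (l + int j) = b l"
      using b by (auto simp: sn_periodic_def)
    have bd: "bounded (range b)" by (rule sn_periodic_bounded[OF b])
    have "translate (int j * k) (diag_op b) = diag_op b" for k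
    proof (rule blinfun_eqI, rule ell2_eqI)
      fix f l
      show "coord (translate (int j * k) (diag_op b) f) l = coord (diag_op b f) l"
        using periodic_mult[of b "int j" "l - int j * k" k] j(2)
        by (simp add: translate_def coord_simps diag_op_coord[OF bd])
    qed
    then show ?thesis using j(1) by (auto simp: almost_periodic_ops_def clinear_diag[OF bd])
  qed
  ultimately show "{V} \<union> Bdiag N \<subseteq> almost_periodic_ops N" by (auto simp: Bdiag_eq)
  show "star_subalgebra (almost_periodic_ops N) \<and> closed (almost_periodic_ops N)"
    by (simp add: star_subalgebra_almost_periodic_ops closed_almost_periodic_ops)
qed

section \<open>Closure properties of \<open>BD N\<close> and its coefficient sequences\<close>

lemma BD_clinear: "A \<in> BD N \<Longrightarrow> clinear_op A"
  using BD_subset_almost_periodic_ops by (auto simp: almost_periodic_ops_def)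

lemma closed_BD: "closed (BD N)"
  unfolding BD_def hull_def by (intro closed_Inter) auto

lemma BD_iff:
  "A \<in> BD N \<longleftrightarrow> (\<forall>S. star_subalgebra S \<longrightarrow> closed S \<longrightarrow> {V} \<union> Bdiag N \<subseteq> S \<longrightarrow> A \<in> S)"
  by (auto simp: BD_def hull_def)

lemma BD_V: "V \<in> BD N"
  by (simp add: BD_iff)
lemma BD_diag_periodic: "sn_periodic N b \<Longrightarrow> diag_op b \<in> BD N"
  by (auto simp add: BD_iff Bdiag_eq)
lemma BD_add: "A \<in> BD N \<Longrightarrow> B \<in> BD N \<Longrightarrow> A + B \<in> BD N"
  unfolding BD_iff using star_subalgebraD(2) by blast
lemma BD_scale: "A \<in> BD N \<Longrightarrow> cscale_op c A \<in> BD N"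
  unfolding BD_iff using star_subalgebraD(3) by blast
lemma BD_compose: "A \<in> BD N \<Longrightarrow> B \<in> BD N \<Longrightarrow> A o\<^sub>L B \<in> BD N"
  unfolding BD_iff using star_subalgebraD(4) by blast
text \<open>Among the shifts only \<open>V\<close> is a generator of \<open>BD N\<close>; the
  inverse enters as its adjoint.\<close>

lemma BD_V_inv: "V_pow (- 1) \<in> BD N"
  unfolding BD_iff
proof (intro allI impI)
  fix S assume S: "star_subalgebra S" "{V} \<union> Bdiag N \<subseteq> S"
  have "\<forall>A\<in>S. \<forall>B. clinear_op B \<and> is_adjoint A B \<longrightarrow> B \<in> S"
    by (rule star_subalgebraD(5)[OF S(1)])
  moreover have "V \<in> S" using S(2) by simp
  ultimately show "V_pow (- 1) \<in> S" using is_adjoint_V_pow[of 1] clinear_V_pow[of "-1"] by blast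
qed
lemma BD_diff: "A \<in> BD N \<Longrightarrow> B \<in> BD N \<Longrightarrow> A - B \<in> BD N"
proof -
  have "cscale_op (- 1) B = - B" by (intro blinfun_eqI) (simp add: blinfun.minus_left)
  then show "A \<in> BD N \<Longrightarrow> B \<in> BD N \<Longrightarrow> A - B \<in> BD N"
    using BD_add[of A N "- B"] BD_scale[of B N "-1"] by simp
qed

lemma BD_V_pow: "V_pow n \<in> BD N"
proof (induction n rule: int_induct[where k = 0])
  case base
  have "sn_periodic N (\<lambda>_. 1)" using sn_divides_1[of N] by (auto simp: sn_periodic_def)
  moreover have "diag_op (\<lambda>_. 1) = id_blinfun"
    by (intro blinfun_eqI ell2_eqI) (simp add: diag_op_coord)
  ultimately show ?case using BD_diag_periodic[of N "\<lambda>_. 1"] by (simp add: V_pow_0)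
next
  case (step1 i) then show ?case using BD_compose[OF _ BD_V] by (simp add: V_pow_add)
next
  case (step2 i) then show ?case using BD_compose[OF _ BD_V_inv, of "V_pow i"] by (simp flip: V_pow_add)
qed

lemma BD_alg_subset_BD: "BD_alg N \<subseteq> BD N"
proof
  fix A assume "A \<in> BD_alg N"
  then show "A \<in> BD N" unfolding BD_alg_eq
    by (induction rule: generated_alg.induct)
      (auto intro: BD_V BD_V_inv BD_diag_periodic BD_add BD_scale BD_compose)
qed

text \<open>An intrinsic form of being a uniform limit of sequences with periods dividing
  \<open>N\<close>.\<close>

definition sn_almost_periodic :: "supernatural \<Rightarrow> (int \<Rightarrow> complex) \<Rightarrow> bool" where
  "sn_almost_periodic N c \<longleftrightarrow>
    (\<forall>e>0. \<exists>j. sn_divides j N \<and> (\<forall>l k. cmod (c (l + int j * k) - c l) \<le> e))"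

lemma BD_entry_almost_periodic:
  assumes "A \<in> BD N"
  shows "sn_almost_periodic N (\<lambda>l. entry A (l + m) l)"
  unfolding sn_almost_periodic_def
proof (intro allI impI)
  fix e :: real assume "0 < e"
  then obtain j where j: "sn_divides j N" "\<And>k. norm (translate (int j * k) A - A) \<le> e"
    using almost_periodic_opsD[OF subsetD[OF BD_subset_almost_periodic_ops assms]] by blast
  have "cmod (entry A (l + int j * k + m) (l + int j * k) - entry A (l + m) l) \<le> e" for l k
    \<comment> \<open>Conjugation by \<open>V_pow s\<close> moves both entry indices by
      \<open>- s\<close>, which explains the sign of \<open>k\<close>.\<close>
    using norm_entry_le[of "translate (int j * (- k)) A - A" "l + m" l] j(2)[of "- k"]
    by (simp add: entry_diff entry_translate algebra_simps)
  with j(1) show "\<exists>j. sn_divides j N \<and> (\<forall>l k. cmod (entry A (l + int j * k + m) (l + int j * k)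
      - entry A (l + m) l) \<le> e)" by blast
qed

lemma sn_almost_periodic_approx:
  assumes "sn_almost_periodic N c" "0 < e"
  obtains b where "sn_periodic N b" "\<And>l. cmod (b l - c l) \<le> e"
proof -
  obtain j where j: "sn_divides j N" "\<And>l k. cmod (c (l + int j * k) - c l) \<le> e"
    using assms by (auto simp: sn_almost_periodic_def)
  show thesis
  proof (rule that)
    \<comment> \<open>The approximant repeats the values of \<open>c\<close> on one block of length
      \<open>j\<close>; uniformity in \<open>k\<close> controls the error.\<close>
    show "sn_periodic N (\<lambda>l. c (l mod int j))"
      using j(1) by (auto simp: sn_periodic_def)
    show "cmod (c (l mod int j) - c l) \<le> e" for l
      using j(2)[of "l mod int j" "l div int j"] by (simp add: norm_minus_commute add.commute)
  qed
qed

lemma sn_almost_periodic_bounded: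
  assumes "sn_almost_periodic N c"
  shows "bounded (range c)"
proof -
  obtain b where b: "sn_periodic N b" "\<And>l. cmod (b l - c l) \<le> 1"
    using sn_almost_periodic_approx[OF assms, of 1] by auto
  obtain B where "\<And>l. cmod (b l) \<le> B" using sn_periodic_bounded[OF b(1)] by (auto simp: bounded_iff)
  then have "cmod (c l) \<le> B + 1" for l
    using b(2)[of l] norm_triangle_ineq4[of "b l" "b l - c l"] by simp (smt (verit))
  then show ?thesis by (auto simp: bounded_iff)
qed

section \<open>Derivations\<close>

definition finitely_supported :: "ell2 \<Rightarrow> bool" where
  "finitely_supported f \<longleftrightarrow> finite {l. coord f l \<noteq> 0}"

lemma finitely_supported_subset:
  "finitely_supported f \<Longrightarrow> (\<And>l. coord g l \<noteq> 0 \<Longrightarrow> coord f l \<noteq> 0) \<Longrightarrow> finitely_supported g"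
  unfolding finitely_supported_def by (auto elim: finite_subset[rotated])

lemma finitely_supported_add:
  assumes "finitely_supported f" "finitely_supported g"
  shows "finitely_supported (f + g)"
  using finite_UnI[OF assms[unfolded finitely_supported_def]]
  unfolding finitely_supported_def by (rule finite_subset[rotated]) (auto simp: coord_simps)

lemma finitely_supported_cscale: "finitely_supported f \<Longrightarrow> finitely_supported (cscale c f)"
  by (erule finitely_supported_subset) (simp add: coord_simps)

lemma finitely_supported_E: "finitely_supported (E l)"
  by (simp add: finitely_supported_def coord_simps)

lemma finitely_supported_V_pow:
  assumes "finitely_supported f"
  shows "finitely_supported (V_pow n f)"
proof -
  have "{l. coord (V_pow n f) l \<noteq> 0} = (\<lambda>l. l - n) -` {l. coord f l \<noteq> 0}"
    by (auto simp: coord_simps)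
  moreover have "finite \<dots>"
    using assms by (intro finite_vimageI) (auto simp: finitely_supported_def inj_on_def)
  ultimately show ?thesis by (simp only: finitely_supported_def)
qed

lemma finitely_supported_span: "f \<in> ell2c.span (range E) \<Longrightarrow> finitely_supported f"
proof -
  have "ell2c.span (range E) \<subseteq> {f. finitely_supported f}"
  proof (rule ell2c.span_minimal)
    show "ell2c.subspace {f. finitely_supported f}"
      by (rule ell2c.subspaceI)
        (auto simp: finitely_supported_add finitely_supported_cscale, simp add: finitely_supported_def coord_simps)
  qed (auto simp: finitely_supported_E)
  then show "f \<in> ell2c.span (range E) \<Longrightarrow> finitely_supported f" by auto
qed

text \<open>Finite support makes the product square summable, so \<open>b\<close> may be unbounded,
  as it is for the index operator.\<close>

lemma coord_mult_seq_finitely_supported: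
  assumes "finitely_supported f"
  shows "coord (mult_seq b f) l = b l * coord f l"
proof -
  have "(\<lambda>l. (cmod (b l * coord f l))\<^sup>2) summable_on UNIV"
    by (rule finite_nonzero_values_imp_summable_on)
      (use assms in \<open>auto simp: finitely_supported_def elim: finite_subset[rotated]\<close>)
  then show ?thesis by (simp add: mult_seq_def Abs_ell2_inverse)
qed

lemma generated_alg_finitely_supported:
  "A \<in> generated_alg N \<Longrightarrow> finitely_supported f \<Longrightarrow> finitely_supported (A f)"
proof (induction arbitrary: f rule: generated_alg.induct)
  case (diag b)
  show ?case
    by (rule finitely_supported_subset[OF diag(2)]) (simp add: diag_op_coord sn_periodic_bounded[OF diag(1)])
qed (auto simp: finitely_supported_V_pow blinfun.add_left finitely_supported_add finitely_supported_cscale)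

text \<open>Tests on finitely supported vectors instead of the span used in
  \<open>bounded_extension\<close>. By \<open>generated_alg_finitely_supported\<close> this domain
  is kept by the algebra, which makes the induction direct.\<close>

definition VL_extension :: "int \<Rightarrow> ell2_op \<Rightarrow> ell2_op \<Rightarrow> bool" where
  "VL_extension n A T \<longleftrightarrow> clinear_op T \<and> (\<forall>f. finitely_supported f \<longrightarrow> T f = commutator_VL n A f)"

lemma VL_extension_bounded_extension:
  "VL_extension n A T \<Longrightarrow> bounded_extension (commutator_VL n A) T"
  by (simp add: VL_extension_def bounded_extension_def finitely_supported_span)

text \<open>Moving the index operator past \<open>V_pow m\<close> adds the scalar \<open>m\<close>
  to it; the unbounded parts cancel and \<open>m\<close> times a shift remains.\<close>

lemma VL_extension_V_pow: "VL_extension n (V_pow m) (cscale_op (of_int m) (V_pow (n + m)))"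
  unfolding VL_extension_def commutator_VL_def
  by (auto intro!: clinear_intros ell2_eqI
      simp: coord_simps coord_mult_seq_finitely_supported finitely_supported_V_pow algebra_simps)

text \<open>A diagonal operator commutes with the index operator, and with \<open>V_pow n\<close>
  because its sequence has period \<open>n\<close>.\<close>

lemma VL_extension_diag:
  assumes "bounded (range b)" "\<And>l. b (l + n) = b l"
  shows "VL_extension n (diag_op b) 0"
proof -
  have "b (l - n) = b l" for l using assms(2)[of "l - n"] by simp
  moreover have "finitely_supported (diag_op b f)" if "finitely_supported f" for f
    by (rule finitely_supported_subset[OF that]) (simp add: diag_op_coord assms(1))
  ultimately show ?thesis
    unfolding VL_extension_def commutator_VL_def
    by (auto intro!: clinear_intros ell2_eqI
      simp: coord_simps coord_mult_seq_finitely_supported diag_op_coord assms(1) algebra_simps)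
qed

lemma mult_seq_add:
  assumes "finitely_supported f" "finitely_supported g"
  shows "mult_seq b (f + g) = mult_seq b f + mult_seq b g"
  by (rule ell2_eqI)
    (simp add: coord_mult_seq_finitely_supported assms finitely_supported_add coord_simps algebra_simps)

lemma mult_seq_cscale:
  assumes "finitely_supported f"
  shows "mult_seq b (cscale c f) = cscale c (mult_seq b f)"
  by (rule ell2_eqI)
    (simp add: coord_mult_seq_finitely_supported assms finitely_supported_cscale coord_simps)

lemma VL_extension_add:
  assumes "VL_extension n A S" "VL_extension n B T" "A \<in> generated_alg N" "B \<in> generated_alg N"
  shows "VL_extension n (A + B) (S + T)"
  using assms(1,2) unfolding VL_extension_def commutator_VL_def
  by (auto intro!: clinear_intros simp: blinfun.add_left blinfun.add_right mult_seq_add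
      generated_alg_finitely_supported[OF assms(3)] generated_alg_finitely_supported[OF assms(4)])

lemma VL_extension_scale:
  assumes "VL_extension n A T" "A \<in> generated_alg N"
  shows "VL_extension n (cscale_op c A) (cscale_op c T)"
  using assms(1) unfolding VL_extension_def commutator_VL_def
  by (auto intro!: clinear_intros simp: mult_seq_cscale generated_alg_finitely_supported[OF assms(2)]
      clinear_opD[OF clinear_V_pow] ell2c.scale_right_diff_distrib)

text \<open>The Leibniz rule for commutators; \<open>B f\<close> stays finitely supported, so the
  hypothesis on \<open>A\<close> applies to it.\<close>

lemma VL_extension_compose:
  assumes "VL_extension n A S" "VL_extension n B T" "A \<in> generated_alg N" "B \<in> generated_alg N"
  shows "VL_extension n (A o\<^sub>L B) ((S o\<^sub>L B) + (A o\<^sub>L T))"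
  using assms(1,2) generated_alg_clinear[OF assms(3)] generated_alg_clinear[OF assms(4)]
  unfolding VL_extension_def commutator_VL_def
  by (auto intro!: clinear_intros simp: blinfun.add_left blinfun.diff_right
      generated_alg_finitely_supported[OF assms(4)])

text \<open>Makes the constant visible: at \<open>V\<close>, the first summand of any decomposition
  must be \<open>C\<close> times \<open>V_pow (n + 1)\<close>.\<close>

lemma VL_extension_V_unique:
  assumes "bounded_extension (commutator_VL n V) T"
  shows "T = V_pow (n + 1)"
proof (rule clinear_op_eqI)
  have "T (E l) = commutator_VL n V (E l)" for l
    using assms ell2c.span_base[of "E l" "range E"] by (auto simp: bounded_extension_def)
  moreover have "V_pow (n + 1) (E l) = commutator_VL n V (E l)" for l
    using VL_extension_V_pow[of n 1] finitely_supported_E[of l] by (simp add: VL_extension_def)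
  ultimately show "entry T k l = entry (V_pow (n + 1)) k l" for k l
    by (simp add: entry_def)
qed (use assms in \<open>auto simp: bounded_extension_def intro!: clinear_intros\<close>)

section \<open>Derivations and limits of commutators, reduced to generators\<close>

lemma derivationD:
  assumes "derivation N \<delta>"
  shows "a \<in> BD_alg N \<Longrightarrow> \<delta> a \<in> BD N"
    "a \<in> BD_alg N \<Longrightarrow> b \<in> BD_alg N \<Longrightarrow> \<delta> (a + b) = \<delta> a + \<delta> b"
    "a \<in> BD_alg N \<Longrightarrow> \<delta> (cscale_op c a) = cscale_op c (\<delta> a)"
    "a \<in> BD_alg N \<Longrightarrow> b \<in> BD_alg N \<Longrightarrow> \<delta> (a o\<^sub>L b) = (\<delta> a o\<^sub>L b) + (a o\<^sub>L \<delta> b)"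
  using assms by (simp_all add: derivation_def)

lemmas BD_alg_intros = generated_alg.intros[folded BD_alg_eq]

text \<open>Differentiate the product of \<open>V_pow (- 1)\<close> and \<open>V\<close>; the
  derivative of the identity is zero because the identity is idempotent.\<close>

lemma derivation_V_inv:
  assumes "derivation N \<delta>"
  shows "\<delta> (V_pow (- 1)) = - (V_pow (- 1) o\<^sub>L \<delta> V o\<^sub>L V_pow (- 1))"
proof -
  have id: "id_blinfun \<in> BD_alg N"
    using BD_alg_intros(6)[OF BD_alg_intros(1,2), of N] V_pow_inverse(2)[of 1] by simp
  have "\<delta> id_blinfun = \<delta> id_blinfun + \<delta> id_blinfun"
    using derivationD(4)[OF assms id id] by simp
  then have "0 = \<delta> (V_pow (- 1) o\<^sub>L V)" by (simp add: V_pow_inverse)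
  also have "\<dots> = (\<delta> (V_pow (- 1)) o\<^sub>L V) + (V_pow (- 1) o\<^sub>L \<delta> V)"
    by (rule derivationD(4)[OF assms]) (auto intro: BD_alg_intros)
  finally have "\<delta> (V_pow (- 1)) o\<^sub>L V = - (V_pow (- 1) o\<^sub>L \<delta> V)"
    by (simp add: eq_neg_iff_add_eq_0)
  then have "(\<delta> (V_pow (- 1)) o\<^sub>L V) o\<^sub>L V_pow (- 1) = - (V_pow (- 1) o\<^sub>L \<delta> V) o\<^sub>L V_pow (- 1)"
    by simp
  moreover have "- X o\<^sub>L Y = - (X o\<^sub>L Y)" for X Y :: ell2_op
    by (rule blinfun_eqI) (simp add: blinfun.minus_left)
  ultimately show ?thesis by (simp add: blinfun_compose_assoc V_pow_inverse)
qed

lemma derivation_commutator: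
  assumes "z \<in> BD N"
  shows "derivation N (commutator z)"
proof -
  have cl: "clinear_op z" by (rule BD_clinear[OF assms])
  have "commutator z a \<in> BD N" if "a \<in> BD_alg N" for a
    using assms that BD_alg_subset_BD by (auto simp: commutator_def intro!: BD_diff BD_compose)
  then show ?thesis
    unfolding derivation_def
    by (auto intro!: blinfun_eqI simp: commutator_def blinfun.bilinear_simps clinear_opD[OF cl]
        ell2c.scale_right_diff_distrib algebra_simps)
qed

lemma commutator_V_inv: "commutator z (V_pow (- 1)) = - (V_pow (- 1) o\<^sub>L commutator z V o\<^sub>L V_pow (- 1))"
  by (rule blinfun_eqI) (simp add: commutator_def blinfun.bilinear_simps V_pow_cancel)

lemma derivation_eqI:
  assumes "derivation N \<delta>" "derivation N \<delta>'" "\<delta> V = \<delta>' V"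
    and "\<And>b. sn_periodic N b \<Longrightarrow> \<delta> (diag_op b) = \<delta>' (diag_op b)"
    and "a \<in> BD_alg N"
  shows "\<delta> a = \<delta>' a"
  using assms(5)[unfolded BD_alg_eq]
proof (induction rule: generated_alg.induct)
  case V_inv
  then show ?case using assms(3) by (simp add: derivation_V_inv[OF assms(1)] derivation_V_inv[OF assms(2)])
qed (auto simp: assms(3,4) derivationD[OF assms(1)] derivationD[OF assms(2)] BD_alg_eq)

lemma bounded_linear_cscale_op: "bounded_linear (cscale_op c)"
proof (rule bounded_linear_intro[where K = "cmod c"])
  show "cscale_op c (r *\<^sub>R A) = r *\<^sub>R cscale_op c A" for r A
    by (rule blinfun_eqI) (simp add: blinfun.scaleR_left scaleR_ell2_eq mult.commute)
  show "cscale_op c (A + B) = cscale_op c A + cscale_op c B" for A B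
    by (rule blinfun_eqI) (simp add: blinfun.add_left ell2c.scale_right_distrib)
qed (simp add: norm_cscale_op_le mult.commute)

lemmas tendsto_cscale_op = bounded_linear.tendsto[OF bounded_linear_cscale_op]
lemmas tendsto_compose_op = bounded_bilinear.tendsto[OF bounded_bilinear_blinfun_compose]

lemma derivation_limit:
  assumes z: "\<And>k. z k \<in> BD N"
    and lim: "\<And>a. a \<in> BD_alg N \<Longrightarrow> (\<lambda>k. commutator (z k) a) \<longlonglongrightarrow> D a"
  shows "derivation N D"
  unfolding derivation_def
proof (intro conjI ballI allI)
  note der = derivation_commutator[OF z]
  fix a b c assume a: "a \<in> BD_alg N"
  show "D a \<in> BD N"
    by (rule closed_sequentially[OF closed_BD _ lim[OF a]]) (rule derivationD(1)[OF der a])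
  have "(\<lambda>k. commutator (z k) (cscale_op c a)) \<longlonglongrightarrow> cscale_op c (D a)"
    unfolding derivationD(3)[OF der a] by (rule tendsto_cscale_op[OF lim[OF a]])
  then show "D (cscale_op c a) = cscale_op c (D a)"
    using LIMSEQ_unique lim[OF BD_alg_intros(5)[OF a]] by blast
  assume b: "b \<in> BD_alg N"
  have "(\<lambda>k. commutator (z k) (a + b)) \<longlonglongrightarrow> D a + D b"
    unfolding derivationD(2)[OF der a b] by (intro tendsto_add lim a b)
  then show "D (a + b) = D a + D b"
    using LIMSEQ_unique lim[OF BD_alg_intros(4)[OF a b]] by blast
  have "(\<lambda>k. commutator (z k) (a o\<^sub>L b)) \<longlonglongrightarrow> (D a o\<^sub>L b) + (a o\<^sub>L D b)"
    unfolding derivationD(4)[OF der a b] by (intro tendsto_add tendsto_compose_op lim a b tendsto_const)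
  then show "D (a o\<^sub>L b) = (D a o\<^sub>L b) + (a o\<^sub>L D b)"
    using LIMSEQ_unique lim[OF BD_alg_intros(6)[OF a b]] by blast
qed

text \<open>The hypotheses concern generators only. The extension \<open>T\<close> and the
  convergence are carried together through the induction, because all the maps involved obey the
  same Leibniz rule.\<close>

lemma derivation_decomposition:
  assumes \<delta>: "derivation N \<delta>" and z: "\<And>k. z k \<in> BD N"
    and V: "(\<lambda>k. commutator (z k) V) \<longlonglongrightarrow> \<delta> V - cscale_op C (V_pow (n + 1))"
    and diag: "\<And>b l. sn_periodic N b \<Longrightarrow> b (l + n) = b l"
      "\<And>b. sn_periodic N b \<Longrightarrow> \<delta> (diag_op b) = 0"
      "\<And>b k. sn_periodic N b \<Longrightarrow> commutator (z k) (diag_op b) = 0"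
    and a: "a \<in> BD_alg N"
  shows "\<exists>T. VL_extension n a T \<and> (\<lambda>k. commutator (z k) a) \<longlonglongrightarrow> \<delta> a - cscale_op C T"
proof -
  note der = derivation_commutator[OF z]
  show ?thesis
    using a[unfolded BD_alg_eq]
  proof (induction rule: generated_alg.induct)
    case V
    have "cscale_op 1 (V_pow (n + 1)) = V_pow (n + 1)" by (rule blinfun_eqI) simp
    then show ?case using VL_extension_V_pow[of n 1] assms(3) by auto
  next
    case V_inv
    have "(\<lambda>k. commutator (z k) (V_pow (- 1))) \<longlonglongrightarrow>
      - (V_pow (- 1) o\<^sub>L (\<delta> V - cscale_op C (V_pow (n + 1))) o\<^sub>L V_pow (- 1))"
      unfolding commutator_V_inv by (intro tendsto_minus tendsto_compose_op tendsto_const V)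
    \<comment> \<open>The two factors \<open>V_pow (- 1)\<close> lower the exponent
      \<open>n + 1\<close> to \<open>n - 1\<close>; the sign is absorbed by the factor
      \<open>m = - 1\<close> from \<open>VL_extension_V_pow\<close>.\<close>
    also have "- (V_pow (- 1) o\<^sub>L (\<delta> V - cscale_op C (V_pow (n + 1))) o\<^sub>L V_pow (- 1)) =
      \<delta> (V_pow (- 1)) - cscale_op C (cscale_op (of_int (- 1)) (V_pow (n + - 1)))"
      unfolding derivation_V_inv[OF \<delta>]
      by (rule blinfun_eqI, rule ell2_eqI)
        (simp add: blinfun.bilinear_simps coord_simps algebra_simps)
    finally show ?case using VL_extension_V_pow[of n "- 1"] by blast
  next
    case (diag b)
    then show ?case
      using VL_extension_diag[OF sn_periodic_bounded[OF diag] assms(4)[OF diag]]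
      by (intro exI[of _ 0]) (simp add: assms(5,6) linear_0 bounded_linear.linear[OF bounded_linear_cscale_op])
  next
    case (add A B)
    then obtain S T where ST: "VL_extension n A S" "VL_extension n B T"
      "(\<lambda>k. commutator (z k) A) \<longlonglongrightarrow> \<delta> A - cscale_op C S" "(\<lambda>k. commutator (z k) B) \<longlonglongrightarrow> \<delta> B - cscale_op C T"
      by blast
    have AB: "A \<in> BD_alg N" "B \<in> BD_alg N" using add by (auto simp: BD_alg_eq)
    have "(\<lambda>k. commutator (z k) (A + B)) \<longlonglongrightarrow> (\<delta> A - cscale_op C S) + (\<delta> B - cscale_op C T)"
      unfolding derivationD(2)[OF der AB] by (intro tendsto_add ST)
    also have "(\<delta> A - cscale_op C S) + (\<delta> B - cscale_op C T) = \<delta> (A + B) - cscale_op C (S + T)"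
      unfolding derivationD(2)[OF \<delta> AB]
      by (rule blinfun_eqI) (simp add: blinfun.bilinear_simps ell2c.scale_right_distrib)
    finally show ?case using VL_extension_add[OF ST(1,2) add(1,2)] by blast
  next
    case (scale A c)
    then obtain S where S: "VL_extension n A S"
      "(\<lambda>k. commutator (z k) A) \<longlonglongrightarrow> \<delta> A - cscale_op C S"
      by blast
    have A: "A \<in> BD_alg N" using scale by (auto simp: BD_alg_eq)
    have "(\<lambda>k. commutator (z k) (cscale_op c A)) \<longlonglongrightarrow> cscale_op c (\<delta> A - cscale_op C S)"
      unfolding derivationD(3)[OF der A] by (intro tendsto_cscale_op S)
    also have "cscale_op c (\<delta> A - cscale_op C S) = \<delta> (cscale_op c A) - cscale_op C (cscale_op c S)"
      unfolding derivationD(3)[OF \<delta> A]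
      by (rule blinfun_eqI) (simp add: blinfun.bilinear_simps ell2c.scale_right_diff_distrib mult.commute)
    finally show ?case using VL_extension_scale[OF S(1) scale(1)] by blast
  next
    case (compose A B)
    then obtain S T where ST: "VL_extension n A S" "VL_extension n B T"
      "(\<lambda>k. commutator (z k) A) \<longlonglongrightarrow> \<delta> A - cscale_op C S" "(\<lambda>k. commutator (z k) B) \<longlonglongrightarrow> \<delta> B - cscale_op C T"
      by blast
    have AB: "A \<in> BD_alg N" "B \<in> BD_alg N" using compose by (auto simp: BD_alg_eq)
    have cl: "clinear_op A" using compose by (auto simp: generated_alg_clinear)
    have "(\<lambda>k. commutator (z k) (A o\<^sub>L B)) \<longlonglongrightarrow>
      ((\<delta> A - cscale_op C S) o\<^sub>L B) + (A o\<^sub>L (\<delta> B - cscale_op C T))"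
      unfolding derivationD(4)[OF der AB] by (intro tendsto_add tendsto_compose_op tendsto_const ST)
    also have "((\<delta> A - cscale_op C S) o\<^sub>L B) + (A o\<^sub>L (\<delta> B - cscale_op C T)) =
      \<delta> (A o\<^sub>L B) - cscale_op C ((S o\<^sub>L B) + (A o\<^sub>L T))"
      unfolding derivationD(4)[OF \<delta> AB]
      by (rule blinfun_eqI)
        (simp add: blinfun.bilinear_simps ell2c.scale_right_distrib clinear_opD[OF cl])
    finally show ?case using VL_extension_compose[OF ST(1,2) compose(1,2)] by blast
  qed
qed

section \<open>Operators supported on a single diagonal\<close>

definition weighted_shift :: "int \<Rightarrow> (int \<Rightarrow> complex) \<Rightarrow> ell2_op" where
  "weighted_shift n c = V_pow n o\<^sub>L diag_op c"

lemma entry_weighted_shift: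
  "bounded (range c) \<Longrightarrow> entry (weighted_shift n c) k l = (if k = l + n then c l else 0)"
  by (auto simp: weighted_shift_def entry_simps)

lemma clinear_weighted_shift: "bounded (range c) \<Longrightarrow> clinear_op (weighted_shift n c)"
  by (simp add: weighted_shift_def clinear_intros)

lemma norm_weighted_shift_le:
  assumes "\<And>l. cmod (c l) \<le> B"
  shows "norm (weighted_shift n c) \<le> B"
proof -
  have "norm (weighted_shift n c) \<le> norm (V_pow n) * norm (diag_op c)"
    unfolding weighted_shift_def by (rule norm_blinfun_compose)
  also have "\<dots> \<le> 1 * B" by (intro mult_mono norm_V_pow_le norm_diag_op_le assms) auto
  finally show ?thesis by simp
qed

text \<open>The coefficient sequence is bounded automatically, since entries are dominated by the
  operator norm.\<close>

lemma weighted_shift_eqI: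
  assumes "clinear_op A" "\<And>k l. k \<noteq> l + n \<Longrightarrow> entry A k l = 0"
  shows "A = weighted_shift n (\<lambda>l. entry A (l + n) l)"
proof -
  have "bounded (range (\<lambda>l. entry A (l + n) l))"
    using norm_entry_le[of A] by (auto simp: bounded_iff)
  then show ?thesis
    by (intro clinear_op_eqI assms(1) clinear_weighted_shift)
      (auto simp: entry_weighted_shift assms(2))
qed

lemma entry_commutator_V: "entry (commutator A V) (k + 1) l = entry A (k + 1) (l + 1) - entry A k l"
  by (simp add: commutator_def entry_simps)

lemma entry_commutator_diag:
  "bounded (range b) \<Longrightarrow> clinear_op A \<Longrightarrow> entry (commutator A (diag_op b)) k l = entry A k l * (b l - b k)"
  by (simp add: commutator_def entry_simps algebra_simps)

lemma bounded_range_shift: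
  "bounded (range (c :: int \<Rightarrow> complex)) \<Longrightarrow> bounded (range (\<lambda>l. c (l + m)))"
  by (auto simp: bounded_iff)

lemma bounded_range_diff:
  fixes a b :: "int \<Rightarrow> complex"
  assumes "bounded (range a)" "bounded (range b)"
  shows "bounded (range (\<lambda>l. a l - b l))"
  using bounded_minus_comp[OF assms, unfolded image_comp] by (simp add: image_def)

text \<open>Turns the operator equation at \<open>V\<close> into a difference equation for
  coefficient sequences.\<close>

lemma commutator_weighted_shift_V:
  assumes "bounded (range c)"
  shows "commutator (weighted_shift n c) V = weighted_shift (n + 1) (\<lambda>l. c (l + 1) - c l)"
proof -
  have bd: "bounded (range (\<lambda>l. c (l + 1) - c l))"
    by (intro bounded_range_diff bounded_range_shift assms)
  show ?thesis
  proof (rule clinear_op_eqI)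
    fix k l
    show "entry (commutator (weighted_shift n c) V) k l = entry (weighted_shift (n + 1) (\<lambda>l. c (l + 1) - c l)) k l"
      using entry_commutator_V[of "weighted_shift n c" "k - 1" l]
      by (auto simp: entry_weighted_shift assms bd)
  qed (auto simp: commutator_def intro!: clinear_intros clinear_weighted_shift assms bd)
qed

lemma weighted_shift_diff:
  assumes "bounded (range a)" "bounded (range b)"
  shows "weighted_shift n a - weighted_shift n b = weighted_shift n (\<lambda>l. a l - b l)"
  using bounded_range_diff[OF assms]
  by (intro clinear_op_eqI clinear_intros clinear_weighted_shift)
    (auto simp: assms entry_diff entry_weighted_shift)

lemma weighted_shift_const: "weighted_shift n (\<lambda>_. c) = cscale_op c (V_pow n)"
  by (intro clinear_op_eqI clinear_intros clinear_weighted_shift)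
    (auto simp: entry_weighted_shift entry_simps)

section \<open>Covariance confines values to one diagonal\<close>

lemma bounded_range_cis: "bounded (range (\<lambda>l::int. cis (f l)))"
  by (auto simp: bounded_iff)

lemma clinear_rho: "clinear_op A \<Longrightarrow> clinear_op (rho t A)"
  by (simp add: rho_def clinear_intros bounded_range_cis)

lemma entry_rho:
  assumes "clinear_op A"
  shows "entry (rho t A) k l = cis (t * (of_int k - of_int l)) * entry A k l"
proof -
  have "entry (rho t A) k l = cis (- (t * of_int l)) * (cis (t * of_int k) * entry A k l)"
    by (simp add: rho_def entry_simps clinear_intros bounded_range_cis assms)
  also have "\<dots> = (cis (- (t * of_int l)) * cis (t * of_int k)) * entry A k l"
    by (rule mult.assoc[symmetric])
  also have "cis (- (t * of_int l)) * cis (t * of_int k) = cis (t * (of_int k - of_int l))"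
    by (simp add: cis_mult algebra_simps)
  finally show ?thesis .
qed

text \<open>Rotation by \<open>t\<close> multiplies the entry at \<open>(k, l)\<close> by a
  character of weight \<open>k - l\<close>, whereas \<open>\<delta>\<close> sends an argument of
  weight \<open>m\<close> to weight \<open>n + m\<close>. A single well-chosen angle separates the
  two weights, without averaging over the circle.\<close>

lemma covariant_entry_eq_0:
  assumes "covariant N n \<delta>" "derivation N \<delta>" and a: "a \<in> BD_alg N"
    and rho: "\<And>t. rho t a = cscale_op (cis (of_int m * t)) a" and "k - l \<noteq> n + m"
  shows "entry (\<delta> a) k l = 0"
proof -
  define p where "p = n + m - (k - l)"
  have p: "p \<noteq> 0" using assms(5) by (simp add: p_def)
  \<comment> \<open>This angle lies in the admissible interval for every nonzero \<open>p\<close>,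
    and \<open>cis (of_int p * t)\<close> is \<open>- 1\<close> whatever the sign of
    \<open>p\<close>.\<close>
  define t where "t = pi / of_int \<bar>p\<bar>"
  have "1 \<le> real_of_int \<bar>p\<bar>" using p by linarith
  then have "t \<le> pi" "0 \<le> t" by (auto simp: t_def divide_le_eq)
  then have t: "t \<in> {0..<2 * pi}" using pi_gt_zero by (simp add: order_le_less_trans)
  have cl: "clinear_op (\<delta> a)" using derivationD(1)[OF assms(2) a] by (rule BD_clinear)
  have "rho (- t) (cscale_op (cis (of_int m * t)) (\<delta> a)) = cscale_op (cis (- (of_int n * t))) (\<delta> a)"
    using assms(1) t a unfolding covariant_def inv_rho
    by (metis rho derivationD(3)[OF assms(2) a])
  then have "cis (- t * (of_int k - of_int l)) * (cis (of_int m * t) * entry (\<delta> a) k l) =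
      cis (- (of_int n * t)) * entry (\<delta> a) k l"
    using entry_rho[OF clinear_scale[OF cl], of "- t" "cis (of_int m * t)" k l]
    by (metis entry_scale)
  moreover have "cis (of_int p * t) = cis (of_int n * t) * (cis (- t * (of_int k - of_int l)) * cis (of_int m * t))"
    by (simp add: cis_mult p_def algebra_simps)
  moreover have "cis (of_int n * t) * cis (- (of_int n * t)) = 1"
    by (simp add: cis_mult)
  ultimately have "cis (of_int p * t) * entry (\<delta> a) k l = entry (\<delta> a) k l"
    by (metis mult.assoc mult_1)
  moreover have "cis (of_int p * t) = - 1"
  proof (cases "0 < p")
    case True
    then have "of_int p * t = pi" by (simp add: t_def)
    then show ?thesis by simp
  next
    case False
    then have "of_int p * t = - pi" using p by (simp add: t_def)
    then show ?thesis by (simp add: complex_eq_iff)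
  qed
  ultimately show ?thesis by (simp add: neg_eq_iff_add_eq_0)
qed

lemma sn_periodic_in_BD_alg: "sn_periodic N b \<Longrightarrow> diag_op b \<in> BD_alg N"
  by (rule BD_alg_intros)

lemma covariant_entry_diag:
  assumes "covariant N n \<delta>" "derivation N \<delta>" "sn_periodic N b" "k \<noteq> l + n"
  shows "entry (\<delta> (diag_op b)) k l = 0"
proof (rule covariant_entry_eq_0[OF assms(1,2) sn_periodic_in_BD_alg[OF assms(3)], where m = 0])
  have bd: "bounded (range b)" by (rule sn_periodic_bounded[OF assms(3)])
  show "rho t (diag_op b) = cscale_op (cis (of_int 0 * t)) (diag_op b)" for t
    by (intro clinear_op_eqI clinear_rho clinear_intros bd)
      (auto simp: entry_rho clinear_intros bd entry_simps)
qed (use assms(4) in auto)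

lemma covariant_entry_V:
  assumes "covariant N n \<delta>" "derivation N \<delta>" "k \<noteq> l + (n + 1)"
  shows "entry (\<delta> V) k l = 0"
proof (rule covariant_entry_eq_0[OF assms(1,2) BD_alg_intros(1), where m = 1])
  show "rho t V = cscale_op (cis (of_int 1 * t)) V" for t
    by (intro clinear_op_eqI clinear_rho clinear_intros)
      (auto simp: entry_rho clinear_intros entry_simps)
qed (use assms(3) in auto)

section \<open>Implementation when some divisor of \<open>N\<close> does not divide
  \<open>n\<close>\<close>

lemma bounded_range_mult:
  fixes a b :: "int \<Rightarrow> complex"
  assumes "bounded (range a)" "bounded (range b)"
  shows "bounded (range (\<lambda>l. a l * b l))"
proof -
  obtain A B where AB: "\<And>l. cmod (a l) \<le> A" "\<And>l. cmod (b l) \<le> B"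
    using assms by (auto simp: bounded_iff)
  then have "cmod (a l * b l) \<le> A * B" for l
    unfolding norm_mult using order_trans[OF norm_ge_zero AB(1)] by (intro mult_mono) auto
  then show ?thesis by (auto simp: bounded_iff)
qed

lemma diag_op_mult:
  assumes "bounded (range a)" "bounded (range b)"
  shows "diag_op (\<lambda>l. a l * b l) = diag_op a o\<^sub>L diag_op b"
  using bounded_range_mult[OF assms]
  by (intro blinfun_eqI ell2_eqI) (simp add: diag_op_coord assms)

lemma derivation_diag_mult:
  assumes "derivation N \<delta>" "sn_periodic N a" "sn_periodic N b"
  shows "entry (\<delta> (diag_op (\<lambda>l. a l * b l))) k l =
    entry (\<delta> (diag_op a)) k l * b l + a k * entry (\<delta> (diag_op b)) k l"
proof -
  have bd: "bounded (range a)" "bounded (range b)" using assms sn_periodic_bounded by auto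
  have cl: "clinear_op (\<delta> (diag_op a))"
    by (rule BD_clinear[OF derivationD(1)[OF assms(1) sn_periodic_in_BD_alg[OF assms(2)]]])
  show ?thesis
    unfolding diag_op_mult[OF bd]
      derivationD(4)[OF assms(1) sn_periodic_in_BD_alg[OF assms(2)] sn_periodic_in_BD_alg[OF assms(3)]]
    by (simp add: entry_simps bd cl)
qed

lemma derivation_diag_commute:
  assumes "derivation N \<delta>" "sn_periodic N a" "sn_periodic N b"
  shows "entry (\<delta> (diag_op a)) k l * (b l - b k) = entry (\<delta> (diag_op b)) k l * (a l - a k)"
  using derivation_diag_mult[OF assms, of k l] derivation_diag_mult[OF assms(1,3,2), of k l]
  by (simp add: mult.commute algebra_simps)

lemma sn_periodic_shift:
  assumes "sn_periodic N a"
  shows "sn_periodic N (\<lambda>l. a (l - m))"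
proof -
  obtain j where j: "sn_divides j N" "\<And>l. a (l + int j) = a l"
    using assms by (auto simp: sn_periodic_def)
  have "a (l + int j - m) = a (l - m)" for l using j(2)[of "l - m"] by (simp add: algebra_simps)
  then show ?thesis using j(1) by (auto simp: sn_periodic_def)
qed

text \<open>Differentiate both sides of the relation that moves \<open>V\<close> past a diagonal
  operator, shifting its sequence by one. Values on the diagonal thus determine the entries of
  \<open>\<delta> V\<close> wherever \<open>a l\<close> and \<open>a (k - 1)\<close> differ.\<close>

lemma derivation_V_diag:
  assumes "derivation N \<delta>" "sn_periodic N a"
  shows "entry (\<delta> V) k l * (a l - a (k - 1)) =
    entry (\<delta> (diag_op (\<lambda>l. a (l - 1)))) k (l + 1) - entry (\<delta> (diag_op a)) (k - 1) l"
proof -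
  let ?a = "\<lambda>l. a (l - 1)"
  note per = sn_periodic_shift[OF assms(2)]
  note bd = sn_periodic_bounded[OF per] sn_periodic_bounded[OF assms(2)]
  have cl: "clinear_op (\<delta> V)" by (rule BD_clinear[OF derivationD(1)[OF assms(1) BD_alg_intros(1)]])
  have "V o\<^sub>L diag_op a = diag_op ?a o\<^sub>L V"
    by (intro blinfun_eqI ell2_eqI) (simp add: diag_op_coord bd coord_simps)
  then have "(\<delta> V o\<^sub>L diag_op a) + (V o\<^sub>L \<delta> (diag_op a)) =
      (\<delta> (diag_op ?a) o\<^sub>L V) + (diag_op ?a o\<^sub>L \<delta> V)"
    using derivationD(4)[OF assms(1) BD_alg_intros(1) sn_periodic_in_BD_alg[OF assms(2)]]
      derivationD(4)[OF assms(1) sn_periodic_in_BD_alg[OF per] BD_alg_intros(1)] by simp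
  then have "entry ((\<delta> V o\<^sub>L diag_op a) + (V o\<^sub>L \<delta> (diag_op a))) k l =
      entry ((\<delta> (diag_op ?a) o\<^sub>L V) + (diag_op ?a o\<^sub>L \<delta> V)) k l" by simp
  then show ?thesis by (simp add: entry_simps bd cl algebra_simps)
qed

lemma inner_derivation_if_not_dvd:
  assumes \<delta>: "derivation N \<delta>" and cov: "covariant N n \<delta>" and j: "sn_divides j N" "\<not> int j dvd n"
  shows "inner_derivation N \<delta>"
proof -
  define a where "a l = cis (2 * pi * of_int l / of_nat j)" for l :: int
  have j0: "0 < j" by (rule sn_divides_pos[OF j(1)])
  have "a (l + int j) = a l" for l
    using j0 cis_2pi by (simp add: a_def distrib_left add_divide_distrib flip: cis_mult)
  then have per: "sn_periodic N a" using j(1) by (auto simp: sn_periodic_def)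
  \<comment> \<open>As \<open>a\<close> is a character, one scalar governs all differences:
    \<open>a l - a (l + n)\<close> is \<open>a l * w\<close>, of constant modulus.\<close>
  define w where "w = 1 - a n"
  have "a n \<noteq> 1"
  proof
    assume "a n = 1"
    then have "cos (2 * pi * of_int n / of_nat j) = 1" by (simp add: a_def complex_eq_iff)
    then obtain x where "2 * pi * of_int n / of_nat j = of_int x * 2 * pi"
      by (auto simp: cos_one_2pi_int)
    then have "real_of_int n = of_int (x * int j)" using j0 by (simp add: field_simps)
    then have "n = x * int j" by (simp only: of_int_eq_iff)
    with j(2) show False by simp
  qed
  then have w: "w \<noteq> 0" by (simp add: w_def)
  have a_diff: "a l - a (l + n) = a l * w" for l
    by (simp add: a_def w_def algebra_simps add_divide_distrib cis_mult)
  have a0: "a l * cnj (a l) = 1" for l by (simp add: a_def cis_cnj cis_mult)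
  then have an0: "a l \<noteq> 0" for l by (metis mult_zero_left zero_neq_one)
  let ?d = "\<lambda>b. \<delta> (diag_op b)"
  have da: "?d a \<in> BD N" by (rule derivationD(1)[OF \<delta> sn_periodic_in_BD_alg[OF per]])
  \<comment> \<open>Because \<open>a l\<close> is unimodular, division by \<open>a l * w\<close> is
    multiplication by \<open>inverse w * cnj (a l)\<close>. In this product form \<open>z\<close>
    visibly lies in \<open>BD N\<close>.\<close>
  define z where "z = cscale_op (inverse w) (?d a o\<^sub>L diag_op (\<lambda>l. cnj (a l)))"
  have z: "z \<in> BD N"
    unfolding z_def by (intro BD_scale BD_compose da BD_diag_periodic sn_periodic_cnj per)
  have entry_z: "entry z k l = inverse w * (cnj (a l) * entry (?d a) k l)" for k l
    by (simp add: z_def entry_simps BD_clinear[OF da] sn_periodic_bounded[OF sn_periodic_cnj[OF per]])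
  have z_off: "entry z k l = 0" if "k \<noteq> l + n" for k l
    by (simp add: entry_z covariant_entry_diag[OF cov \<delta> per that])
  have z_a: "entry z k l * (a l - a k) = entry (?d a) k l" for k l
  proof (cases "k = l + n")
    case True
    have "entry z k l * (a l - a k) = (inverse w * w) * (a l * cnj (a l)) * entry (?d a) k l"
      unfolding True a_diff by (simp only: entry_z mult_ac)
    then show ?thesis using w by (simp add: a0)
  qed (simp add: z_off covariant_entry_diag[OF cov \<delta> per])
  have z_b: "entry z k l * (b l - b k) = entry (?d b) k l" if b: "sn_periodic N b" for b k l
  proof (cases "k = l + n")
    case True
    \<comment> \<open>Commutativity of the diagonal transfers the identity from \<open>a\<close> to
      \<open>b\<close>; the nonzero factor \<open>a l - a k\<close> then cancels.\<close>
    have "(entry z k l * (b l - b k)) * (a l - a k) = entry (?d b) k l * (a l - a k)"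
      using derivation_diag_commute[OF \<delta> per b, of k l] by (simp add: mult_ac flip: z_a)
    then show ?thesis using w an0 by (simp add: True a_diff)
  qed (simp add: z_off covariant_entry_diag[OF cov \<delta> b])
  \<comment> \<open>The relation between \<open>V\<close> and \<open>a\<close> forces the value at
    \<open>V\<close>, so \<open>z\<close>, built from the diagonal alone, implements
    \<open>\<delta>\<close> there as well.\<close>
  have z_V: "entry z k (l + 1) - entry z (k - 1) l = entry (\<delta> V) k l" for k l
  proof (cases "k = l + (n + 1)")
    case True
    have "entry (\<delta> V) k l * (a l - a (k - 1)) = (entry z k (l + 1) - entry z (k - 1) l) * (a l - a (k - 1))"
      unfolding derivation_V_diag[OF \<delta> per] z_b[OF sn_periodic_shift[OF per], symmetric]
        z_b[OF per, symmetric] by (simp add: algebra_simps)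
    moreover have "k - 1 = l + n" using True by simp
    ultimately show ?thesis using w an0 by (simp add: a_diff)
  qed (use z_off covariant_entry_V[OF cov \<delta>] in auto)
  have cl: "clinear_op A" if "A \<in> BD N" for A using that by (rule BD_clinear)
  have V: "\<delta> V = commutator z V"
  proof (rule clinear_op_eqI)
    show "entry (\<delta> V) k l = entry (commutator z V) k l" for k l
      using entry_commutator_V[of z "k - 1" l] by (simp add: z_V)
  qed (auto intro!: cl derivationD(1)[OF \<delta>] derivationD(1)[OF derivation_commutator[OF z]] BD_alg_intros)
  have diag: "\<delta> (diag_op b) = commutator z (diag_op b)" if b: "sn_periodic N b" for b
  proof (rule clinear_op_eqI)
    show "entry (?d b) k l = entry (commutator z (diag_op b)) k l" for k l
      by (simp add: entry_commutator_diag cl[OF z] sn_periodic_bounded[OF b] z_b[OF b])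
  qed (use b in \<open>auto intro!: cl derivationD(1)[OF \<delta>] derivationD(1)[OF derivation_commutator[OF z]]
      sn_periodic_in_BD_alg\<close>)
  have "\<delta> a = commutator z a" if "a \<in> BD_alg N" for a
    by (rule derivation_eqI[OF \<delta> derivation_commutator[OF z] V diag that])
  then show ?thesis using \<delta> z by (auto simp: inner_derivation_def)
qed

section \<open>Diagonal values and primitives when every divisor of \<open>N\<close> divides
  \<open>n\<close>\<close>

lemma sn_periodic_dvd:
  assumes "sn_periodic N b" "\<And>j. sn_divides j N \<Longrightarrow> int j dvd n"
  shows "b (l + n) = b l"
proof -
  obtain j where j: "sn_divides j N" "\<And>l. b (l + int j) = b l"
    using assms(1) by (auto simp: sn_periodic_def)
  obtain k where "n = int j * k" using assms(2)[OF j(1)] by (rule dvdE)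
  then show ?thesis using periodic_mult[of b "int j" l k, OF j(2)] by simp
qed

text \<open>An idempotent \<open>e\<close> commuting with \<open>V\<^sup>n\<close> satisfies \<open>\<delta> e = 2 e \<delta> e\<close>, so \<open>\<delta> e = 0\<close>; indicators
  of residue classes then detect the coefficients of \<open>\<delta> b\<close>.\<close>

lemma covariant_derivation_diag_eq_0:
  assumes \<delta>: "derivation N \<delta>" and cov: "covariant N n \<delta>"
    and n: "\<And>j. sn_divides j N \<Longrightarrow> int j dvd n" and b: "sn_periodic N b"
  shows "\<delta> (diag_op b) = 0"
proof (rule clinear_op_eqI)
  show "clinear_op (\<delta> (diag_op b))"
    by (rule BD_clinear[OF derivationD(1)[OF \<delta> sn_periodic_in_BD_alg[OF b]]])
  obtain j where j: "sn_divides j N" "\<And>l. b (l + int j) = b l"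
    using b by (auto simp: sn_periodic_def)
  fix k r
  have "entry (\<delta> (diag_op b)) k r = 0"
  proof (cases "k = r + n")
    case True
    \<comment> \<open>The indicator of the residue class of \<open>r\<close>. As \<open>j\<close>
      divides \<open>n\<close>, the class also contains \<open>k = r + n\<close>, so
      \<open>e\<close> is \<open>1\<close> at both indices.\<close>
    define e :: "int \<Rightarrow> complex" where "e l = (if l mod int j = r mod int j then 1 else 0)" for l
    have e: "sn_periodic N e" using j(1) by (auto simp: sn_periodic_def e_def)
    have ee: "(\<lambda>l. e l * e l) = e" by (auto simp: e_def)
    have ek: "e k = 1" "e r = 1"
      using sn_periodic_dvd[OF e n, of r] by (simp_all add: True e_def)
    have "entry (\<delta> (diag_op e)) k r = entry (\<delta> (diag_op e)) k r + entry (\<delta> (diag_op e)) k r"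
      using derivation_diag_mult[OF \<delta> e e, of k r] by (simp add: ee ek)
    then have de: "entry (\<delta> (diag_op e)) k r = 0" by simp
    \<comment> \<open>On the class selected by \<open>e\<close> the sequence \<open>b\<close> is
      constant, so multiplication by \<open>e\<close> reduces \<open>b\<close> to the scalar
      \<open>b r\<close>.\<close>
    have "b l * e l = b r * e l" for l
      using periodic_mod[of b "int j" l, OF j(2)] periodic_mod[of b "int j" r, OF j(2)]
      by (simp add: e_def)
    then have "diag_op (\<lambda>l. b l * e l) = cscale_op (b r) (diag_op e)"
      using sn_periodic_bounded[OF e] bounded_range_mult[OF sn_periodic_bounded[OF b] sn_periodic_bounded[OF e]]
      by (intro blinfun_eqI ell2_eqI) (simp add: diag_op_coord coord_simps flip: mult.assoc)
    then have "entry (\<delta> (diag_op b)) k r + b k * entry (\<delta> (diag_op e)) k r = b r * entry (\<delta> (diag_op e)) k r"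
      using derivation_diag_mult[OF \<delta> b e, of k r]
      by (simp add: ek derivationD(3)[OF \<delta> sn_periodic_in_BD_alg[OF e]] entry_scale)
    then show ?thesis by (simp add: de)
  qed (rule covariant_entry_diag[OF cov \<delta> b])
  then show "entry (\<delta> (diag_op b)) k r = entry 0 k r" by (simp add: entry_def coord_simps)
qed (rule clinear_zero)

text \<open>\<open>C\<close> is the mean over one period, and \<open>\<beta>\<close> is a partial
  sum of \<open>c - C\<close> restarted at each multiple of \<open>j\<close>; removing the mean
  makes the restart consistent. The bound on \<open>C\<close> later gives compactness of a sequence
  of means.\<close>

lemma periodic_primitive:
  fixes c :: "int \<Rightarrow> complex"
  assumes "0 < j" "\<And>l. c (l + j) = c l"
  shows "\<exists>C \<beta>. (\<forall>l. \<beta> (l + j) = \<beta> l) \<and> (\<forall>l. \<beta> (l + 1) - \<beta> l = c l - C) \<and>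
    (\<forall>B. (\<forall>l. cmod (c l) \<le> B) \<longrightarrow> cmod C \<le> B)"
proof -
  define C where "C = (\<Sum>k\<in>{0..<j}. c k) / of_int j"
  define \<beta> where "\<beta> l = (\<Sum>k\<in>{0..<l mod j}. c k - C)" for l
  have total: "(\<Sum>k\<in>{0..<j}. c k - C) = 0"
    using assms(1) by (simp add: sum_subtractf C_def)
  have ins: "{0..<m + 1} = insert m {0..<m}" if "0 \<le> m" for m :: int using that by auto
  have "\<beta> (l + 1) - \<beta> l = c l - C" for l
  proof -
    define m where "m = l mod j"
    have m: "0 \<le> m" "m < j" using assms(1) by (auto simp: m_def)
    have c: "c l = c m" unfolding m_def using periodic_mod[of c j l, OF assms(2)] .
    have S: "(\<Sum>k\<in>{0..<m + 1}. c k - C) = (c m - C) + (\<Sum>k\<in>{0..<m}. c k - C)"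
      using m by (simp add: ins)
    have ml: "(l + 1) mod j = (m + 1) mod j" by (simp add: m_def mod_add_left_eq)
    show ?thesis
    proof (cases "m + 1 = j")
      case True
      \<comment> \<open>At the wrap-around \<open>\<beta>\<close> returns to the empty sum;
        \<open>total\<close> supplies the required increment.\<close>
      then have "(l + 1) mod j = 0" by (simp add: ml)
      then show ?thesis using S total True by (simp add: \<beta>_def c flip: m_def) (simp add: add_eq_0_iff)
    next
      case False
      then have "(l + 1) mod j = m + 1" using m by (simp add: ml)
      then show ?thesis using S by (simp add: \<beta>_def c flip: m_def)
    qed
  qed
  moreover have "cmod C \<le> B" if "\<forall>l. cmod (c l) \<le> B" for B
  proof -
    have "cmod (\<Sum>k\<in>{0..<j}. c k) \<le> (\<Sum>k\<in>{0..<j}. B)" using that by (intro sum_norm_le) auto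
    then show ?thesis using assms(1) by (simp add: C_def norm_divide divide_le_eq mult.commute)
  qed
  moreover have "\<beta> (l + j) = \<beta> l" for l by (simp add: \<beta>_def)
  ultimately show ?thesis by blast
qed

lemma sn_periodic_primitive:
  assumes "sn_periodic N c"
  shows "\<exists>C \<beta>. sn_periodic N \<beta> \<and> (\<forall>l. \<beta> (l + 1) - \<beta> l = c l - C) \<and>
    (\<forall>B. (\<forall>l. cmod (c l) \<le> B) \<longrightarrow> cmod C \<le> B)"
proof -
  obtain j where j: "sn_divides j N" "\<And>l. c (l + int j) = c l"
    using assms by (auto simp: sn_periodic_def)
  have "0 < int j" using sn_divides_pos[OF j(1)] by simp
  from periodic_primitive[of "int j" c, OF this j(2)] obtain C \<beta> where
    "\<forall>l. \<beta> (l + int j) = \<beta> l" "\<forall>l. \<beta> (l + 1) - \<beta> l = c l - C"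
    "\<forall>B. (\<forall>l. cmod (c l) \<le> B) \<longrightarrow> cmod C \<le> B" by blast
  then show ?thesis using j(1) by (intro exI[of _ C] exI[of _ \<beta>]) (auto simp: sn_periodic_def)
qed

lemma weighted_shift_BD: "sn_periodic N b \<Longrightarrow> weighted_shift n b \<in> BD N"
  unfolding weighted_shift_def by (intro BD_compose BD_V_pow BD_diag_periodic)

lemma commutator_weighted_shift_diag:
  assumes "bounded (range c)" "bounded (range b)" "\<And>l. b (l + n) = b l"
  shows "commutator (weighted_shift n c) (diag_op b) = 0"
proof (rule clinear_op_eqI)
  show "entry (commutator (weighted_shift n c) (diag_op b)) k l = entry 0 k l" for k l
    by (simp add: entry_commutator_diag clinear_weighted_shift assms entry_weighted_shift)
      (simp add: entry_def coord_simps)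
qed (auto simp: commutator_def intro!: clinear_intros clinear_weighted_shift assms)

text \<open>The decomposition for commutants \<open>z\<^sub>k\<close> of the diagonal, when \<open>[z\<^sub>k, V]\<close> converges to the part of
  \<open>\<delta> V\<close> not accounted for by \<open>C [V\<^sup>n \<L>, V] = C V\<^bsup>n+1\<^esup>\<close>.\<close>

lemma decomposes_limit:
  assumes \<delta>: "derivation N \<delta>" and cov: "covariant N n \<delta>"
    and n: "\<And>j. sn_divides j N \<Longrightarrow> int j dvd n"
    and per: "\<And>k. sn_periodic N (\<beta> k)"
    and V: "(\<lambda>k. commutator (weighted_shift n (\<beta> k)) V) \<longlonglongrightarrow> \<delta> V - cscale_op C (V_pow (n + 1))"
    and a: "a \<in> BD_alg N"
  shows "\<exists>T. VL_extension n a T \<and>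
    (\<lambda>k. commutator (weighted_shift n (\<beta> k)) a) \<longlonglongrightarrow> \<delta> a - cscale_op C T"
proof (rule derivation_decomposition[OF \<delta> weighted_shift_BD[OF per] V])
  show "b (l + n) = b l" if "sn_periodic N b" for b l
    by (rule sn_periodic_dvd[OF that n])
  then show "commutator (weighted_shift n (\<beta> k)) (diag_op b) = 0" if "sn_periodic N b" for b k
    using that per by (intro commutator_weighted_shift_diag sn_periodic_bounded)
  show "\<delta> (diag_op b) = 0" if "sn_periodic N b" for b
    by (rule covariant_derivation_diag_eq_0[OF \<delta> cov n that])
qed (rule a)

lemma covariant_derivation_V:
  assumes "derivation N \<delta>" "covariant N n \<delta>"
  obtains c where "\<delta> V = weighted_shift (n + 1) c" "sn_almost_periodic N c"
proof (rule that)
  have V: "\<delta> V \<in> BD N" by (rule derivationD(1)[OF assms(1) BD_alg_intros(1)])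
  show "\<delta> V = weighted_shift (n + 1) (\<lambda>l. entry (\<delta> V) (l + (n + 1)) l)"
    by (rule weighted_shift_eqI[OF BD_clinear[OF V] covariant_entry_V[OF assms(2,1)]])
  show "sn_almost_periodic N (\<lambda>l. entry (\<delta> V) (l + (n + 1)) l)"
    by (rule BD_entry_almost_periodic[OF V])
qed

lemma decomposes_inner:
  assumes \<delta>: "derivation N \<delta>" and cov: "covariant N n \<delta>"
    and fin: "sn_finite N" and n: "int (sn_value N) dvd n"
  shows "\<exists>C \<delta>'. decomposes N n \<delta> C \<delta>' \<and> inner_derivation N \<delta>'"
proof -
  have n': "int j dvd n" if "sn_divides j N" for j
    using sn_divides_imp_dvd_sn_value[OF fin that] n by (meson dvd_trans of_nat_dvd_iff)
  obtain c where c: "\<delta> V = weighted_shift (n + 1) c" "sn_almost_periodic N c"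
    by (rule covariant_derivation_V[OF \<delta> cov])
  have bc: "bounded (range c)" by (rule sn_almost_periodic_bounded[OF c(2)])
  \<comment> \<open>\<open>sn_value N\<close> is a multiple of every \<open>j\<close> dividing
    \<open>N\<close>, so this shift changes \<open>c\<close> by at most \<open>e\<close> for all
    \<open>e\<close>: almost periodicity collapses to periodicity.\<close>
  have "c (l + int (sn_value N)) = c l" for l
  proof -
    have "cmod (c (l + int (sn_value N)) - c l) \<le> e" if "0 < e" for e
    proof -
      obtain j where j: "sn_divides j N" "\<And>l k. cmod (c (l + int j * k) - c l) \<le> e"
        using c(2) \<open>0 < e\<close> by (auto simp: sn_almost_periodic_def)
      obtain m where m: "sn_value N = j * m"
        using sn_divides_imp_dvd_sn_value[OF fin j(1)] by (rule dvdE)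
      show ?thesis using j(2)[of l "int m"] by (simp add: m)
    qed
    then have "cmod (c (l + int (sn_value N)) - c l) \<le> 0"
      by (rule field_le_epsilon[where y = "0::real", simplified])
    then show ?thesis by simp
  qed
  then have "sn_periodic N c" using sn_divides_sn_value[OF fin] by (auto simp: sn_periodic_def)
  from sn_periodic_primitive[OF this]
  obtain C \<beta> where \<beta>: "sn_periodic N \<beta>" "\<And>l. \<beta> (l + 1) - \<beta> l = c l - C"
    by blast
  let ?z = "weighted_shift n \<beta>"
  have "commutator ?z V = \<delta> V - cscale_op C (V_pow (n + 1))"
    by (simp add: commutator_weighted_shift_V sn_periodic_bounded[OF \<beta>(1)] \<beta>(2) c(1) bc
        weighted_shift_diff flip: weighted_shift_const)
  then have dec: "\<exists>T. VL_extension n a T \<and> commutator ?z a = \<delta> a - cscale_op C T" if "a \<in> BD_alg N" for a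
    \<comment> \<open>Applied to a constant sequence of operators, where convergence means
      equality.\<close>
    using decomposes_limit[OF \<delta> cov n' \<beta>(1) _ that, of C] by (simp add: LIMSEQ_const_iff)
  have "decomposes N n \<delta> C (commutator ?z)"
    unfolding decomposes_def
  proof
    fix a assume "a \<in> BD_alg N"
    from dec[OF this] obtain T where "VL_extension n a T" "commutator ?z a = \<delta> a - cscale_op C T"
      by blast
    then show "\<exists>T. bounded_extension (commutator_VL n a) T \<and> \<delta> a = cscale_op C T + commutator ?z a"
      by (intro exI[of _ T]) (simp add: VL_extension_bounded_extension)
  qed
  moreover have "inner_derivation N (commutator ?z)"
    using weighted_shift_BD[OF \<beta>(1)] derivation_commutator by (auto simp: inner_derivation_def)
  ultimately show ?thesis by blast
qed

text \<open>The primitives of the periodic approximants may grow with \<open>k\<close>, so the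
  operators built from them need not converge; along a subsequence their commutators do.\<close>

lemma decomposes_approx_inner:
  assumes \<delta>: "derivation N \<delta>" and cov: "covariant N n \<delta>"
    and n: "\<And>j. sn_divides j N \<Longrightarrow> int j dvd n"
  shows "\<exists>C \<delta>'. decomposes N n \<delta> C \<delta>' \<and> approx_inner_derivation N \<delta>'"
proof -
  obtain c where c: "\<delta> V = weighted_shift (n + 1) c" "sn_almost_periodic N c"
    by (rule covariant_derivation_V[OF \<delta> cov])
  have bc: "bounded (range c)" by (rule sn_almost_periodic_bounded[OF c(2)])
  then obtain B where B: "\<And>l. cmod (c l) \<le> B" by (auto simp: bounded_iff)
  \<comment> \<open>The bound \<open>B + 1\<close> is independent of \<open>k\<close>: each
    approximant is within \<open>1 / Suc k \<le> 1\<close> of \<open>c\<close>, and a mean obeys the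
    bound of its sequence.\<close>
  define approx where "approx k b C \<beta> \<longleftrightarrow> sn_periodic N b \<and> sn_periodic N \<beta> \<and>
      (\<forall>l. \<beta> (l + 1) - \<beta> l = b l - C) \<and> (\<forall>l. cmod (b l - c l) \<le> 1 / Suc k) \<and> cmod C \<le> B + 1"
    for k :: nat and b \<beta> C
  have "\<exists>b C \<beta>. approx k b C \<beta>" for k
  proof -
    obtain b where b: "sn_periodic N b" "\<And>l. cmod (b l - c l) \<le> 1 / Suc k"
      using sn_almost_periodic_approx[OF c(2), of "1 / Suc k"] by auto
    obtain C \<beta> where \<beta>: "sn_periodic N \<beta>" "\<forall>l. \<beta> (l + 1) - \<beta> l = b l - C"
      "\<forall>B. (\<forall>l. cmod (b l) \<le> B) \<longrightarrow> cmod C \<le> B"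
      using sn_periodic_primitive[OF b(1)] by blast
    have "cmod (b l) \<le> B + 1" for l
    proof -
      have "cmod (b l) \<le> cmod (c l) + cmod (b l - c l)" by (rule norm_triangle_sub)
      moreover have "1 / real (Suc k) \<le> 1" by simp
      ultimately show ?thesis using B[of l] b(2)[of l] by linarith
    qed
    then show ?thesis using b \<beta> unfolding approx_def by blast
  qed
  then obtain b C \<beta> where approx: "\<And>k. approx k (b k) (C k) (\<beta> k)" by metis
  have \<beta>: "\<And>k. sn_periodic N (\<beta> k)" "\<And>k. sn_periodic N (b k)"
    "\<And>k l. \<beta> k (l + 1) - \<beta> k l = b k l - C k"
    "\<And>k l. cmod (b k l - c l) \<le> 1 / Suc k" "\<And>k. cmod (C k) \<le> B + 1"
    using approx unfolding approx_def by blast+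
  have "bounded (range C)" using \<beta>(5) by (auto simp: bounded_iff)
  then obtain C0 r where r: "strict_mono r" "(\<lambda>k. C (r k)) \<longlonglongrightarrow> C0"
    using bounded_imp_convergent_subsequence[of C] by (auto simp: o_def)
  let ?z = "\<lambda>k. weighted_shift n (\<beta> (r k))"
  have V: "(\<lambda>k. commutator (?z k) V) \<longlonglongrightarrow> \<delta> V - cscale_op C0 (V_pow (n + 1))"
  proof (rule LIM_zero_cancel, rule Lim_null_comparison)
    have bb: "bounded (range (\<lambda>l. b k l - x))" for k x
      by (intro bounded_range_diff sn_periodic_bounded[OF \<beta>(2)]) simp
    have bc': "bounded (range (\<lambda>l. c l - x))" for x
      by (intro bounded_range_diff bc) simp
    have "norm (commutator (?z k) V - (\<delta> V - cscale_op C0 (V_pow (n + 1)))) \<le>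
        1 / real (Suc (r k)) + cmod (C (r k) - C0)" for k
    proof -
      have 1: "commutator (?z k) V = weighted_shift (n + 1) (\<lambda>l. b (r k) l - C (r k))"
        by (simp add: commutator_weighted_shift_V sn_periodic_bounded[OF \<beta>(1)] \<beta>(3))
      have 2: "\<delta> V - cscale_op C0 (V_pow (n + 1)) = weighted_shift (n + 1) (\<lambda>l. c l - C0)"
        by (simp add: c(1) bc weighted_shift_diff flip: weighted_shift_const)
      have 3: "cmod ((b (r k) l - C (r k)) - (c l - C0)) \<le> 1 / real (Suc (r k)) + cmod (C (r k) - C0)" for l
      proof -
        have eq: "(b (r k) l - C (r k)) - (c l - C0) = (b (r k) l - c l) - (C (r k) - C0)" by simp
        show ?thesis
          unfolding eq using norm_triangle_ineq4[of "b (r k) l - c l" "C (r k) - C0"] \<beta>(4)[of "r k" l] by linarith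
      qed
      show ?thesis
        unfolding 1 2 weighted_shift_diff[OF bb bc'] by (rule norm_weighted_shift_le[OF 3])
    qed
    then show "\<forall>\<^sub>F k in sequentially. norm (commutator (?z k) V - (\<delta> V - cscale_op C0 (V_pow (n + 1)))) \<le>
        1 / real (Suc (r k)) + cmod (C (r k) - C0)"
      by (rule always_eventually[OF allI])
    have "(\<lambda>k. 1 / real (Suc (r k))) \<longlonglongrightarrow> 0"
      using LIMSEQ_subseq_LIMSEQ[OF LIMSEQ_inverse_real_of_nat r(1)] by (simp add: o_def inverse_eq_divide)
    moreover have "(\<lambda>k. cmod (C (r k) - C0)) \<longlonglongrightarrow> 0"
      using r(2) by (simp add: LIM_zero tendsto_norm_zero)
    ultimately show "(\<lambda>k. 1 / real (Suc (r k)) + cmod (C (r k) - C0)) \<longlonglongrightarrow> 0"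
      by (rule tendsto_add_zero)
  qed
  have dec: "\<exists>T. VL_extension n a T \<and> (\<lambda>k. commutator (?z k) a) \<longlonglongrightarrow> \<delta> a - cscale_op C0 T"
    if "a \<in> BD_alg N" for a
    by (rule decomposes_limit[OF \<delta> cov n \<beta>(1) V that])
  \<comment> \<open>\<open>dec\<close> only asserts that some \<open>T\<close> exists for each
    \<open>a\<close>, so the approximately inner part is defined by the limit itself.\<close>
  define D where "D a = lim (\<lambda>k. commutator (?z k) a)" for a
  have D: "(\<lambda>k. commutator (?z k) a) \<longlonglongrightarrow> D a" if "a \<in> BD_alg N" for a
    unfolding D_def using dec[OF that] by (auto simp: convergent_LIMSEQ_iff[symmetric] intro: convergentI)
  have "decomposes N n \<delta> C0 D"
    unfolding decomposes_def
  proof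
    fix a assume a: "a \<in> BD_alg N"
    from dec[OF a] obtain T where T: "VL_extension n a T"
      "(\<lambda>k. commutator (?z k) a) \<longlonglongrightarrow> \<delta> a - cscale_op C0 T" by blast
    have "D a = \<delta> a - cscale_op C0 T" by (rule LIMSEQ_unique[OF D[OF a] T(2)])
    then show "\<exists>T. bounded_extension (commutator_VL n a) T \<and> \<delta> a = cscale_op C0 T + D a"
      using T(1) by (intro exI[of _ T]) (simp add: VL_extension_bounded_extension)
  qed
  moreover have "approx_inner_derivation N D"
    unfolding approx_inner_derivation_def
  proof (intro conjI exI allI ballI)
    show "derivation N D" by (rule derivation_limit[OF weighted_shift_BD[OF \<beta>(1)] D])
  qed (rule weighted_shift_BD[OF \<beta>(1)], rule D)
  ultimately show ?thesis by blast
qed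

text \<open>The coefficients of \<open>z\<^sub>k\<close> are bounded sequences, whereas increments near a nonzero constant
  would make them grow linearly.\<close>

lemma commutator_V_limit_eq_0:
  assumes "(\<lambda>k. commutator (z k) V) \<longlonglongrightarrow> cscale_op K (V_pow (n + 1))"
  shows "K = 0"
proof (rule ccontr)
  assume K: "K \<noteq> 0"
  then obtain k where k: "norm (commutator (z k) V - cscale_op K (V_pow (n + 1))) < cmod K / 2"
    using LIMSEQ_D[OF assms, of "cmod K / 2"] by auto
  define \<beta> where "\<beta> l = entry (z k) (l + n) l" for l
  have step: "cmod (\<beta> (l + 1) - \<beta> l - K) \<le> cmod K / 2" for l
  proof -
    have "entry (commutator (z k) V - cscale_op K (V_pow (n + 1))) (l + n + 1) l = \<beta> (l + 1) - \<beta> l - K"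
      unfolding entry_diff entry_commutator_V entry_scale entry_V \<beta>_def by (simp add: add_ac)
    then show ?thesis
      using norm_entry_le[of "commutator (z k) V - cscale_op K (V_pow (n + 1))" "l + n + 1" l] k by simp
  qed
  \<comment> \<open>The accumulated error is at most half of the drift \<open>m * K\<close>.\<close>
  have lin: "cmod (\<beta> (int m) - \<beta> 0 - of_nat m * K) \<le> of_nat m * (cmod K / 2)" for m
  proof (induction m)
    case (Suc m)
    have "\<beta> (int (Suc m)) - \<beta> 0 - of_nat (Suc m) * K =
      (\<beta> (int m) - \<beta> 0 - of_nat m * K) + (\<beta> (int m + 1) - \<beta> (int m) - K)"
      by (simp add: algebra_simps)
    also have "cmod \<dots> \<le> of_nat m * (cmod K / 2) + cmod K / 2"
      by (intro norm_triangle_mono Suc step)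
    finally show ?case by (simp add: algebra_simps)
  qed simp
  \<comment> \<open>The drift leaves at least \<open>m * cmod K / 2\<close>, whereas two entries
    differ by at most \<open>2 * norm (z k)\<close>; hence the factor \<open>4\<close>.\<close>
  obtain m :: nat where m: "4 * norm (z k) < of_nat m * cmod K"
    using K ex_less_of_nat_mult[of "cmod K" "4 * norm (z k)"] by auto
  have "cmod (of_nat m * K) \<le> cmod (\<beta> (int m) - \<beta> 0 - of_nat m * K) + cmod (\<beta> (int m) - \<beta> 0)"
    using norm_triangle_ineq4[of "\<beta> (int m) - \<beta> 0" "\<beta> (int m) - \<beta> 0 - of_nat m * K"] by simp
  moreover have "cmod (\<beta> (int m) - \<beta> 0) \<le> norm (z k) + norm (z k)"
    unfolding \<beta>_def by (intro order_trans[OF norm_triangle_ineq4] add_mono norm_entry_le)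
  ultimately show False using lin[of m] m by (simp add: norm_mult)
qed

text \<open>A constant sequence suffices; this lets both exceptional cases share one uniqueness
  argument.\<close>

lemma inner_imp_approx_inner:
  assumes "inner_derivation N \<delta>"
  shows "approx_inner_derivation N \<delta>"
proof -
  obtain z where z: "z \<in> BD N" "\<forall>b\<in>BD_alg N. \<delta> b = commutator z b"
    using assms by (auto simp: inner_derivation_def)
  have "\<forall>b\<in>BD_alg N. (\<lambda>j. commutator z b) \<longlonglongrightarrow> \<delta> b" using z(2) by simp
  then show ?thesis
    using assms z(1) unfolding approx_inner_derivation_def inner_derivation_def
    by (intro conjI exI[of _ "\<lambda>_. z"]) simp_all
qed

text \<open>Comparing the decompositions at \<open>V\<close> alone presents \<open>C' - C\<close>
  times \<open>V_pow (n + 1)\<close> as a limit of commutators with \<open>V\<close>, which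
  \<open>commutator_V_limit_eq_0\<close> allows only for a zero factor.\<close>

lemma decomposes_unique:
  assumes "decomposes N n \<delta> C D" "approx_inner_derivation N D"
    and "decomposes N n \<delta> C' D'" "approx_inner_derivation N D'"
  shows "C = C'"
proof -
  have V: "V \<in> BD_alg N" by (rule BD_alg_intros)
  have eq: "\<delta> V = cscale_op C (V_pow (n + 1)) + D V" "\<delta> V = cscale_op C' (V_pow (n + 1)) + D' V"
    using assms(1,3) V VL_extension_V_unique unfolding decomposes_def by blast+
  obtain z z' where z: "(\<lambda>k. commutator (z k) V) \<longlonglongrightarrow> D V" "(\<lambda>k. commutator (z' k) V) \<longlonglongrightarrow> D' V"
    using assms(2,4) V unfolding approx_inner_derivation_def by blast
  have "(\<lambda>k. commutator (z k) V - commutator (z' k) V) \<longlonglongrightarrow> D V - D' V"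
    by (intro tendsto_diff z)
  moreover have "commutator (z k) V - commutator (z' k) V = commutator (z k - z' k) V" for k
    by (rule blinfun_eqI) (simp add: commutator_def blinfun.bilinear_simps)
  moreover have "D V - D' V = cscale_op (C' - C) (V_pow (n + 1))"
  proof -
    have "cscale_op (C' - C) (V_pow (n + 1)) = cscale_op C' (V_pow (n + 1)) - cscale_op C (V_pow (n + 1))"
      by (rule blinfun_eqI) (simp add: blinfun.diff_left ell2c.scale_left_diff_distrib)
    also have "\<dots> = D V - D' V" using eq by (simp add: algebra_simps)
    finally show ?thesis by simp
  qed
  ultimately have "C' - C = 0" by (intro commutator_V_limit_eq_0) simp
  then show ?thesis by simp
qed

theorem theorem3p12:
  fixes N :: supernatural and n :: int and \<delta> :: "ell2_op \<Rightarrow> ell2_op"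
  assumes "derivation N \<delta>" and "covariant N n \<delta>"
  shows "if (\<not> sn_finite N \<and> n \<noteq> 0) \<or> (sn_finite N \<and> \<not> int (sn_value N) dvd n)
    then inner_derivation N \<delta>
    else \<exists>!C. \<exists>\<delta>'. decomposes N n \<delta> C \<delta>' \<and>
      (sn_finite N \<and> int (sn_value N) dvd n \<longrightarrow> inner_derivation N \<delta>') \<and>
      (\<not> sn_finite N \<and> n = 0 \<longrightarrow> approx_inner_derivation N \<delta>')"
proof (cases "(\<not> sn_finite N \<and> n \<noteq> 0) \<or> (sn_finite N \<and> \<not> int (sn_value N) dvd n)")
  case True
  then have "\<exists>j. sn_divides j N \<and> \<not> int j dvd n"
  proof (elim disjE conjE)
    assume "\<not> sn_finite N" "n \<noteq> 0"
    \<comment> \<open>A divisor of \<open>N\<close> larger than the absolute value of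
      \<open>n\<close> cannot divide the nonzero \<open>n\<close>.\<close>
    then obtain j where j: "sn_divides j N" "nat \<bar>n\<bar> < j" using sn_infinite_divides_large by blast
    have "\<not> int j dvd n"
    proof
      assume "int j dvd n"
      then have "\<bar>int j\<bar> \<le> \<bar>n\<bar>" by (rule dvd_imp_le_int[OF \<open>n \<noteq> 0\<close>])
      then show False using j(2) by linarith
    qed
    with j(1) show ?thesis by blast
  \<comment> \<open>For finite \<open>N\<close> the witness is \<open>sn_value N\<close>
    itself.\<close>
  qed (use sn_divides_sn_value in blast)
  then have "inner_derivation N \<delta>" using inner_derivation_if_not_dvd[OF assms] by blast
  then show ?thesis using True by simp
next
  case False
  then consider (fin) "sn_finite N" "int (sn_value N) dvd n" | (inf) "\<not> sn_finite N" "n = 0" by blast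
  then have "\<exists>!C. \<exists>\<delta>'. decomposes N n \<delta> C \<delta>' \<and>
      (sn_finite N \<and> int (sn_value N) dvd n \<longrightarrow> inner_derivation N \<delta>') \<and>
      (\<not> sn_finite N \<and> n = 0 \<longrightarrow> approx_inner_derivation N \<delta>')" (is "\<exists>!C. ?P C")
  proof cases
    case fin
    show ?thesis
    proof (rule ex_ex1I)
      show "\<exists>C. ?P C" using decomposes_inner[OF assms fin] fin by blast
      show "C = C'" if "?P C" "?P C'" for C C'
        using that fin decomposes_unique inner_imp_approx_inner by blast
    qed
  next
    case inf
    show ?thesis
    proof (rule ex_ex1I)
      show "\<exists>C. ?P C" using decomposes_approx_inner[OF assms] inf by auto
      show "C = C'" if "?P C" "?P C'" for C C'
        using that inf decomposes_unique by blast
    qed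
  qed
  then show ?thesis by (subst if_not_P[OF False])
qed

end
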